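(* M-EPVCB is fixed-parameter tractable when parameterized by $|V_{\ge 2}|$, the number of vertices of the input graph of degree at least $2$.
   Context: Graphs are finite, simple, undirected; $V_{\ge 2}$ denotes the set of vertices of degree at least $2$. For $V_0\subseteq V(G)$, $E(V_0)$ denotes the set of edges with at least one endpoint in $V_0$. M-EPVCB: given a bipartite graph $G=(V,E)$, an edge-weight function $w:E\to\mathbb{N}$ (positive integers), and positive integers $k_1,k_2,k_3$, decide whether there exists $V_0\subseteq V$ with $|V_0|\le k_1$ such that $\sum_{e\in E(V_0)}w(e)\ge k_2$ and $E(V_0)$ contains a matching $M$ with $\sum_{e\in M}w(e)\ge k_3$. *)

theory Defs
  imports
    Complex_Main
    "HOL-Library.Log_Nat"
    "HOL-Library.Disjoint_Sets"
    "HOL-Computational_Algebra.Polynomial"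
begin

section \<open>Random access machines\<close>

text \<open>
  Registers hold natural numbers and every instruction costs one step; the arithmetic is
  addition, truncated subtraction and halving. Without multiplication, the length of the numbers
  grows by at most one bit per step, so that running times with respect to the bit length of
  the input agree with those of Turing machines up to a polynomial.

  The input is a read-only sequence of natural numbers, accessed by \<open>Read\<close>; its length is
  initially in register 0. A program halts when the program counter leaves it, and its output is
  then the content of register 0.
\<close>

datatype instr =
    Const nat nat
  | Add nat nat nat
  | Sub nat nat nat
  | Half nat nat
  | Load nat nat
  | Store nat nat
  | Read nat nat
  | Jump nat
  | JumpZero nat nat

type_synonym config = "nat \<times> (nat \<Rightarrow> nat)"

fun exec_instr :: "nat list \<Rightarrow> instr \<Rightarrow> config \<Rightarrow> config" where
  "exec_instr xs (Const r c) (pc, R) = (Suc pc, R(r := c))"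
| "exec_instr xs (Add r s t) (pc, R) = (Suc pc, R(r := R s + R t))"
| "exec_instr xs (Sub r s t) (pc, R) = (Suc pc, R(r := R s - R t))"
| "exec_instr xs (Half r s) (pc, R) = (Suc pc, R(r := R s div 2))"
| "exec_instr xs (Load r s) (pc, R) = (Suc pc, R(r := R (R s)))"
| "exec_instr xs (Store r s) (pc, R) = (Suc pc, R(R r := R s))"
| "exec_instr xs (Read r s) (pc, R) =
     (Suc pc, R(r := if R s < length xs then xs ! R s else 0))"
| "exec_instr xs (Jump l) (pc, R) = (l, R)"
| "exec_instr xs (JumpZero r l) (pc, R) = (if R r = 0 then l else Suc pc, R)"

definition step :: "instr list \<Rightarrow> nat list \<Rightarrow> config \<Rightarrow> config" where
  "step P xs c = (if fst c < length P then exec_instr xs (P ! fst c) c else c)"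

definition init_config :: "nat list \<Rightarrow> config" where
  "init_config xs = (0, (\<lambda>_. 0)(0 := length xs))"

text \<open>
  Halted configurations are fixed by \<^const>\<open>step\<close>, so the following says that \<open>P\<close> halts
  on \<open>xs\<close> within at most \<open>t\<close> steps, with output \<open>y\<close>.
\<close>

definition outputs_within :: "instr list \<Rightarrow> nat list \<Rightarrow> nat \<Rightarrow> nat \<Rightarrow> bool" where
  "outputs_within P xs t y \<longleftrightarrow>
     (\<exists>pc R. (step P xs ^^ t) (init_config xs) = (pc, R) \<and> length P \<le> pc \<and> R 0 = y)"

definition computable :: "(nat \<Rightarrow> nat) \<Rightarrow> bool" where
  "computable f \<longleftrightarrow> (\<exists>P. \<forall>k. \<exists>t. outputs_within P [k] t (f k))"


section \<open>Fixed-parameter tractability\<close>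

text \<open>The binary length of the input, with one further symbol per number as a separator.\<close>

definition input_size :: "nat list \<Rightarrow> nat" where
  "input_size xs = (\<Sum>x\<leftarrow>xs. floorlog 2 x + 1)"

definition fpt :: "nat list set \<Rightarrow> (nat list \<Rightarrow> nat) \<Rightarrow> bool" where
  "fpt Q \<kappa> \<longleftrightarrow>
     (\<exists>P f (p :: nat poly). computable f \<and>
        (\<forall>xs. outputs_within P xs (f (\<kappa> xs) * poly p (input_size xs)) (if xs \<in> Q then 1 else 0)))"


section \<open>Graphs\<close>

definition simple_graph :: "'a set \<Rightarrow> 'a set set \<Rightarrow> bool" where
  "simple_graph V E \<longleftrightarrow> finite V \<and> (\<forall>e\<in>E. \<exists>u\<in>V. \<exists>v\<in>V. u \<noteq> v \<and> e = {u, v})"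

definition bipartite :: "'a set \<Rightarrow> 'a set set \<Rightarrow> bool" where
  "bipartite V E \<longleftrightarrow>
     (\<exists>X Y. X \<union> Y = V \<and> X \<inter> Y = {} \<and> (\<forall>e\<in>E. \<exists>x\<in>X. \<exists>y\<in>Y. e = {x, y}))"

definition degree_in :: "'a set set \<Rightarrow> 'a \<Rightarrow> nat" where
  "degree_in E v = card {e \<in> E. v \<in> e}"

definition V_ge2 :: "'a set \<Rightarrow> 'a set set \<Rightarrow> 'a set" where
  "V_ge2 V E = {v \<in> V. 2 \<le> degree_in E v}"

definition edges_at :: "'a set set \<Rightarrow> 'a set \<Rightarrow> 'a set set" where
  "edges_at E V0 = {e \<in> E. e \<inter> V0 \<noteq> {}}"


section \<open>The problem M-EPVCB\<close>

definition mepvcb_yes ::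
  "'a set \<Rightarrow> 'a set set \<Rightarrow> ('a set \<Rightarrow> nat) \<Rightarrow> nat \<Rightarrow> nat \<Rightarrow> nat \<Rightarrow> bool" where
  "mepvcb_yes V E w k1 k2 k3 \<longleftrightarrow>
     (\<exists>V0 \<subseteq> V. card V0 \<le> k1 \<and> k2 \<le> (\<Sum>e\<in>edges_at E V0. w e) \<and>
        (\<exists>M \<subseteq> edges_at E V0. disjoint M \<and> k3 \<le> (\<Sum>e\<in>M. w e)))"

definition weighted_graph :: "'a set \<Rightarrow> 'a set set \<Rightarrow> ('a set \<Rightarrow> nat) \<Rightarrow> bool" where
  "weighted_graph V E w \<longleftrightarrow> simple_graph V E \<and> (\<forall>e\<in>E. 0 < w e)"

text \<open>
  A graph with vertex set \<open>{..<n}\<close> is given by its weighted adjacency matrix, row by row;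
  the entry 0 stands for a non-edge, which is unambiguous as weights are positive.
\<close>

definition encode ::
  "nat \<Rightarrow> nat set set \<Rightarrow> (nat set \<Rightarrow> nat) \<Rightarrow> nat \<Rightarrow> nat \<Rightarrow> nat \<Rightarrow> nat list" where
  "encode n E w k1 k2 k3 = [n, k1, k2, k3] @
     concat (map (\<lambda>i. map (\<lambda>j. if {i, j} \<in> E then w {i, j} else 0) [0..<n]) [0..<n])"

definition M_EPVCB :: "nat list set" where
  "M_EPVCB = {encode n E w k1 k2 k3 | n E w k1 k2 k3.
     weighted_graph {..<n} E w \<and> bipartite {..<n} E \<and> 0 < k1 \<and> 0 < k2 \<and> 0 < k3 \<and>
     mepvcb_yes {..<n} E w k1 k2 k3}"

text \<open>The value on sequences that do not encode a weighted graph is immaterial; it is set to 0.\<close>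

definition num_V_ge2 :: "nat list \<Rightarrow> nat" where
  "num_V_ge2 xs =
     (if \<exists>n E w k1 k2 k3. weighted_graph {..<n} E w \<and> xs = encode n E w k1 k2 k3
      then THE k. \<exists>n E w k1 k2 k3. weighted_graph {..<n} E w \<and> xs = encode n E w k1 k2 k3 \<and>
             k = card (V_ge2 {..<n} E)
      else 0)"


subsection \<open>Unambiguity of the encoding\<close>

lemma concat_map_upt_eq:
  assumes "concat (map (\<lambda>i. map (f i) [0..<n]) [0..<m]) = concat (map (\<lambda>i. map (g i) [0..<n]) [0..<m])"
    and "i < m" "j < n"
  shows "f i j = g i j"
  using assms
proof (induction m)
  case (Suc m)
  have "length (concat (map (\<lambda>i. map (f i) [0..<n]) [0..<m])) =
        length (concat (map (\<lambda>i. map (g i) [0..<n]) [0..<m]))"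
    by (simp add: length_concat comp_def)
  with Suc.prems(1)
  have "concat (map (\<lambda>i. map (f i) [0..<n]) [0..<m]) = concat (map (\<lambda>i. map (g i) [0..<n]) [0..<m])"
    and "map (f m) [0..<n] = map (g m) [0..<n]"
    by simp_all
  with Suc.IH Suc.prems(2,3) show ?case
    by (cases "i = m") auto
qed simp

lemma encode_eq_iff:
  assumes "weighted_graph {..<n} E w" "weighted_graph {..<n'} E' w'"
  shows "encode n E w k1 k2 k3 = encode n' E' w' k1' k2' k3' \<longleftrightarrow>
    n = n' \<and> E = E' \<and> (\<forall>e\<in>E. w e = w' e) \<and> k1 = k1' \<and> k2 = k2' \<and> k3 = k3'"
proof
  assume eq: "encode n E w k1 k2 k3 = encode n' E' w' k1' k2' k3'"
  hence n: "n' = n" and ks: "k1 = k1'" "k2 = k2'" "k3 = k3'"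
    by (auto simp: encode_def)
  have entry: "(if {i, j} \<in> E then w {i, j} else 0) = (if {i, j} \<in> E' then w' {i, j} else 0)"
    if "i < n" "j < n" for i j
    using eq that
    by (intro concat_map_upt_eq[of "\<lambda>i j. if {i, j} \<in> E then w {i, j} else 0" n n])
       (auto simp: encode_def n)
  have pos: "\<And>e. e \<in> E \<Longrightarrow> 0 < w e" "\<And>e. e \<in> E' \<Longrightarrow> 0 < w' e"
    using assms by (auto simp: weighted_graph_def)
  note edges = assms[unfolded weighted_graph_def simple_graph_def n, THEN conjunct1, THEN conjunct2]
  have same: "(e \<in> E \<longleftrightarrow> e \<in> E') \<and> w e = w' e" if e: "e \<in> E \<union> E'" for e
  proof -
    obtain i j where "i < n" "j < n" "e = {i, j}"
      using e edges by (metis UnE lessThan_iff)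
    then have "(if e \<in> E then w e else 0) = (if e \<in> E' then w' e else 0)"
      using entry[of i j] by (simp only:)
    with pos[of e] e show ?thesis
      by (cases "e \<in> E"; cases "e \<in> E'") simp_all
  qed
  then have "E = E'" "\<forall>e\<in>E. w e = w' e" by blast+
  then show "n = n' \<and> E = E' \<and> (\<forall>e\<in>E. w e = w' e) \<and> k1 = k1' \<and> k2 = k2' \<and> k3 = k3'"
    using n ks by simp
next
  assume "n = n' \<and> E = E' \<and> (\<forall>e\<in>E. w e = w' e) \<and> k1 = k1' \<and> k2 = k2' \<and> k3 = k3'"
  then show "encode n E w k1 k2 k3 = encode n' E' w' k1' k2' k3'"
    by (simp add: encode_def cong: if_cong)
qed

lemma num_V_ge2_encode:
  assumes "weighted_graph {..<n} E w"
  shows "num_V_ge2 (encode n E w k1 k2 k3) = card (V_ge2 {..<n} E)"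
proof -
  let ?P = "\<lambda>k. \<exists>n' E' w' k1' k2' k3'. weighted_graph {..<n'} E' w' \<and>
      encode n E w k1 k2 k3 = encode n' E' w' k1' k2' k3' \<and> k = card (V_ge2 {..<n'} E')"
  have "(THE k. ?P k) = card (V_ge2 {..<n} E)"
  proof (rule the_equality)
    show "?P (card (V_ge2 {..<n} E))" using assms by blast
  next
    fix k assume "?P k"
    then obtain n' E' w' k1' k2' k3' where *: "weighted_graph {..<n'} E' w'"
      "encode n E w k1 k2 k3 = encode n' E' w' k1' k2' k3'" "k = card (V_ge2 {..<n'} E')"
      by blast
    from *(2) show "k = card (V_ge2 {..<n} E)"
      unfolding encode_eq_iff[OF assms *(1)] *(3) by simp
  qed
  moreover have "\<exists>n' E' w' k1' k2' k3'. weighted_graph {..<n'} E' w' \<and>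
      encode n E w k1 k2 k3 = encode n' E' w' k1' k2' k3'"
    using assms by blast
  ultimately show ?thesis unfolding num_V_ge2_def by (simp only: if_True)
qed

lemma mepvcb_yes_cong:
  assumes "\<forall>e\<in>E. w e = w' e"
  shows "mepvcb_yes V E w k1 k2 k3 \<longleftrightarrow> mepvcb_yes V E w' k1 k2 k3"
proof -
  have sum_eq: "sum w A = sum w' A" if "A \<subseteq> E" for A
    using that assms by (intro sum.cong) auto
  have at: "edges_at E V0 \<subseteq> E" for V0 by (auto simp: edges_at_def)
  have "(\<exists>M \<subseteq> edges_at E V0. disjoint M \<and> k3 \<le> sum w M) \<longleftrightarrow>
        (\<exists>M \<subseteq> edges_at E V0. disjoint M \<and> k3 \<le> sum w' M)" for V0
    by (intro ex_cong1 conj_cong refl) (simp add: sum_eq[OF subset_trans[OF _ at]])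
  then show ?thesis
    unfolding mepvcb_yes_def sum_eq[OF at] by simp
qed

lemma encode_in_M_EPVCB_iff:
  assumes "weighted_graph {..<n} E w"
  shows "encode n E w k1 k2 k3 \<in> M_EPVCB \<longleftrightarrow>
    bipartite {..<n} E \<and> 0 < k1 \<and> 0 < k2 \<and> 0 < k3 \<and> mepvcb_yes {..<n} E w k1 k2 k3"
    (is "?L \<longleftrightarrow> ?R")
proof
  assume ?L
  then obtain n' E' w' k1' k2' k3' where
    *: "encode n E w k1 k2 k3 = encode n' E' w' k1' k2' k3'" "weighted_graph {..<n'} E' w'"
      "bipartite {..<n'} E'" "0 < k1'" "0 < k2'" "0 < k3'" "mepvcb_yes {..<n'} E' w' k1' k2' k3'"
    unfolding M_EPVCB_def by blast
  from *(1) have eqs: "n = n'" "E = E'" "\<forall>e\<in>E. w e = w' e" "k1 = k1'" "k2 = k2'" "k3 = k3'"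
    unfolding encode_eq_iff[OF assms *(2)] by simp_all
  show ?R
    using *(3-7) mepvcb_yes_cong[OF eqs(3)] by (simp add: eqs(1,2,4,5,6))
next
  assume ?R
  with assms show ?L unfolding M_EPVCB_def by blast
qed

end

theory Submission
  imports Defs
begin

text \<open>
  Let \<open>H\<close> be the set of vertices of degree at least 2 and \<open>k = |H|\<close>. Every other
  non-isolated vertex is either a pendant of a vertex of \<open>H\<close> or an end of an isolated edge. By
  exchange, the pendant edges used by the matching can be taken to be the heaviest ones, one for each vertex of \<open>H\<close>; so apart from isolated
  edges the matching lives on a core of at most \<open>2k\<close> vertices. One guesses the part of \<open>V0\<close> and
  of the matching inside the core, at most \<open>4k\<^sup>2\<close> bits. What remains is to choose pendants of
  unselected vertices, which count for coverage only, and isolated edges, which count for both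
  objectives; in either class the heaviest ones are optimal, so it suffices to try all pairs of weight
  thresholds. Bipartiteness is decided by guessing a 2-colouring of \<open>H\<close>.

  To run this on a random access machine, the algorithm is written as an expression built from bounded
  sums and iterations, which is compiled with an exact account of its cost.
\<close>

section \<open>An expression language compiled to random access machines\<close>

text \<open>The exponent: each vertex of \<open>H\<close> brings at most itself and one heaviest
  pendant into the core, which thus has at most \<open>2k\<close> vertices, and one bit for each
  ordered pair of them makes \<open>(2k)^2 = 4k^2\<close>.

  Weights may be exponential in the length of the input, so a threshold cannot range over weights.
  It ranges over vertices instead, ordered by weighted degree with ties broken by the vertex number;
  distinct keys make every cardinality attainable by a threshold, so an optimal choice of prescribed
  size is always among the candidates.

  The machine must answer on every input, encoding or not, and the time bound must hold there too.
  Hence all loops are cut off at the input length, except the computation of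
  \<open>2 ^ (4k^2)\<close> and the two enumerations of that range; these are reached only after the
  input has been recognised as a weighted graph.

  Bipartiteness is a condition on membership, so it has to be decided as well; a 2-colouring of
  \<open>H\<close> extends to the other vertices because they have degree at most 1.\<close>

datatype exp =
    Var nat | Num nat | Len
  | Plus exp exp | Minus exp exp | Halve exp | Inp exp
  | Ifz exp exp exp
  | Bind exp exp
  | Sum exp exp
  | Iter exp exp exp

primrec eval :: "nat list \<Rightarrow> nat list \<Rightarrow> exp \<Rightarrow> nat" where
  "eval xs \<rho> (Var i) = (if i < length \<rho> then \<rho> ! i else 0)"
| "eval xs \<rho> (Num c) = c"
| "eval xs \<rho> Len = length xs"
| "eval xs \<rho> (Plus a b) = eval xs \<rho> a + eval xs \<rho> b"
| "eval xs \<rho> (Minus a b) = eval xs \<rho> a - eval xs \<rho> b"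
| "eval xs \<rho> (Halve a) = eval xs \<rho> a div 2"
| "eval xs \<rho> (Inp a) = (if eval xs \<rho> a < length xs then xs ! eval xs \<rho> a else 0)"
| "eval xs \<rho> (Ifz c a b) = (if eval xs \<rho> c = 0 then eval xs \<rho> a else eval xs \<rho> b)"
| "eval xs \<rho> (Bind a b) = eval xs (eval xs \<rho> a # \<rho>) b"
| "eval xs \<rho> (Sum m b) = (\<Sum>i<eval xs \<rho> m. eval xs (i # \<rho>) b)"
| "eval xs \<rho> (Iter m a b) = ((\<lambda>y. eval xs (y # \<rho>) b) ^^ eval xs \<rho> m) (eval xs \<rho> a)"

text \<open>The summand for \<open>Iter\<close> is indexed by the loop counter, which runs
  downwards: at counter value \<open>i\<close> the accumulator has already been updated
  \<open>N - Suc i\<close> times, where \<open>N\<close> is the number of rounds. The 4 in each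
  round and the 1 after the last pay for the loop control.\<close>

primrec cost :: "nat list \<Rightarrow> nat list \<Rightarrow> exp \<Rightarrow> nat" where
  "cost xs \<rho> (Var i) = 2"
| "cost xs \<rho> (Num c) = 1"
| "cost xs \<rho> Len = 2"
| "cost xs \<rho> (Plus a b) = cost xs \<rho> a + cost xs \<rho> b + 1"
| "cost xs \<rho> (Minus a b) = cost xs \<rho> a + cost xs \<rho> b + 1"
| "cost xs \<rho> (Halve a) = cost xs \<rho> a + 1"
| "cost xs \<rho> (Inp a) = cost xs \<rho> a + 1"
| "cost xs \<rho> (Ifz c a b) =
     cost xs \<rho> c + (if eval xs \<rho> c = 0 then cost xs \<rho> a + 1 else cost xs \<rho> b + 2)"
| "cost xs \<rho> (Bind a b) = cost xs \<rho> a + (cost xs (eval xs \<rho> a # \<rho>) b + 2)"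
| "cost xs \<rho> (Sum m b) =
     1 + (cost xs \<rho> m + (1 + (\<Sum>i<eval xs \<rho> m. cost xs (i # \<rho>) b + 1 + 4)))"
| "cost xs \<rho> (Iter m a b) =
     cost xs \<rho> a + (cost xs \<rho> m + (1 + (\<Sum>i<eval xs \<rho> m.
       cost xs (((\<lambda>y. eval xs (y # \<rho>) b) ^^ (eval xs \<rho> m - Suc i)) (eval xs \<rho> a) # \<rho>) b + 2 + 4)))"

section \<open>Compilation into machine code\<close>

definition move :: "nat \<Rightarrow> nat \<Rightarrow> instr list" where
  "move r s = [Const r 0, Add r s r]"

text \<open>The code for a nonzero register comes first; the two extra steps of that case are the
  test and the jump over \<open>ca\<close>.\<close>

definition branch :: "nat \<Rightarrow> nat \<Rightarrow> instr list \<Rightarrow> instr list \<Rightarrow> instr list" where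
  "branch p r cb ca = [JumpZero r (p + length cb + 2)] @ cb @
     [Jump (p + length cb + 2 + length ca)] @ ca"

text \<open>The counter \<open>r\<close> is lowered before the body, which thus sees the values from
  the number of rounds minus 1 down to 0. Register \<open>t\<close> supplies the 1 to subtract and
  may be overwritten by the body.\<close>

definition loop :: "nat \<Rightarrow> nat \<Rightarrow> nat \<Rightarrow> instr list \<Rightarrow> instr list" where
  "loop p r t cb = [JumpZero r (p + length cb + 4), Const t 1, Sub r r t] @ cb @ [Jump p]"

text \<open>
  In \<open>compile e p rs d\<close>, \<open>p\<close> is the address of the code, \<open>rs\<close> lists the registers of the variables
  and \<open>d\<close> is the register for the result; all registers below \<open>d\<close> are preserved, and register 0
  keeps the input length.
\<close>

primrec compile :: "exp \<Rightarrow> nat \<Rightarrow> nat list \<Rightarrow> nat \<Rightarrow> instr list" where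
  "compile (Var i) p rs d = (if i < length rs then move d (rs ! i) else [Const d 0, Const d 0])"
| "compile (Num c) p rs d = [Const d c]"
| "compile Len p rs d = move d 0"
| "compile (Plus a b) p rs d =
    (let ca = compile a p rs d; cb = compile b (p + length ca) rs (d + 1)
     in (ca @ cb) @ [Add d d (d + 1)])"
| "compile (Minus a b) p rs d =
    (let ca = compile a p rs d; cb = compile b (p + length ca) rs (d + 1)
     in (ca @ cb) @ [Sub d d (d + 1)])"
| "compile (Halve a) p rs d = compile a p rs d @ [Half d d]"
| "compile (Inp a) p rs d = compile a p rs d @ [Read d d]"
| "compile (Ifz c a b) p rs d =
    (let cc = compile c p rs d; q = p + length cc;
         cb = compile b (q + 1) rs d; ca = compile a (q + length cb + 2) rs d
     in cc @ branch q d cb ca)"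
| "compile (Bind a b) p rs d =
    (let ca = compile a p rs d; cb = compile b (p + length ca) (d # rs) (d + 1)
     in ca @ (cb @ move d (d + 1)))"
| "compile (Sum m b) p rs d =
    (let cm = compile m (p + 1) rs (d + 1); q = p + 1 + length cm;
         cb = compile b (q + 3) ((d + 1) # rs) (d + 2)
     in [Const d 0] @ (cm @ loop q (d + 1) (d + 2) (cb @ [Add d d (d + 2)])))"
| "compile (Iter m a b) p rs d =
    (let ca = compile a p rs d; cm = compile m (p + length ca) rs (d + 1);
         q = p + length ca + length cm; cb = compile b (q + 3) (d # rs) (d + 2)
     in ca @ (cm @ loop q (d + 1) (d + 2) (cb @ move d (d + 2))))"

section \<open>Execution of code fragments\<close>

definition code_at :: "instr list \<Rightarrow> nat \<Rightarrow> instr list \<Rightarrow> bool" where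
  "code_at P p cs \<longleftrightarrow> (\<exists>A B. P = A @ cs @ B \<and> length A = p)"

lemma code_at_append:
  "code_at P p (cs @ ds) \<Longrightarrow> code_at P p cs \<and> code_at P (p + length cs) ds"
  unfolding code_at_def by (metis append.assoc length_append)

lemma code_at_step: "code_at P p (i # cs) \<Longrightarrow> step P xs (p, R) = exec_instr xs i (p, R)"
  by (auto simp: code_at_def step_def)

text \<open>Jumps are absolute, so the address is fixed; quantifying over all programs that contain
  the fragment there is what lets fragments be composed.\<close>

definition runs :: "nat list \<Rightarrow> nat \<Rightarrow> instr list \<Rightarrow> nat \<Rightarrow> (nat \<Rightarrow> nat) \<Rightarrow> (nat \<Rightarrow> nat) \<Rightarrow> bool" where
  "runs xs p cs t R R' \<longleftrightarrow>
     (\<forall>P. code_at P p cs \<longrightarrow> (step P xs ^^ t) (p, R) = (p + length cs, R'))"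

lemma step_add: "(step P xs ^^ t) c = c' \<Longrightarrow> (step P xs ^^ u) c' = c'' \<Longrightarrow> (step P xs ^^ (t + u)) c = c''"
  by (simp add: add.commute[of t u] funpow_add)

lemma runs_append:
  assumes "runs xs p cs t R R'" "runs xs (p + length cs) ds u R' R''"
  shows "runs xs p (cs @ ds) (t + u) R R''"
  unfolding runs_def
proof (intro allI impI)
  fix P assume "code_at P p (cs @ ds)"
  then have "code_at P p cs" "code_at P (p + length cs) ds"
    using code_at_append by blast+
  with assms have "(step P xs ^^ t) (p, R) = (p + length cs, R')"
    "(step P xs ^^ u) (p + length cs, R') = (p + length cs + length ds, R'')"
    by (auto simp: runs_def)
  from step_add[OF this] show "(step P xs ^^ (t + u)) (p, R) = (p + length (cs @ ds), R'')"
    by (simp add: add.assoc)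
qed

lemma runs_single:
  assumes "exec_instr xs i (p, R) = (Suc p, R')"
  shows "runs xs p [i] 1 R R'"
  using assms by (auto simp: runs_def code_at_step)

lemma runs_move: "r \<noteq> s \<Longrightarrow> runs xs p (move r s) 2 R (R(r := R s))"
  using runs_append[of xs p "[Const r 0]" 1 R "R(r := 0)" "[Add r s r]" 1 "R(r := R s)"]
  by (simp add: move_def numeral_2_eq_2 runs_single[unfolded One_nat_def])

lemma runs_branch:
  assumes "R r = 0 \<Longrightarrow> runs xs (p + length cb + 2) ca t R R'"
    and "R r \<noteq> 0 \<Longrightarrow> runs xs (p + 1) cb u R R'"
  shows "runs xs p (branch p r cb ca) (if R r = 0 then t + 1 else u + 2) R R'"
  unfolding runs_def
proof (intro allI impI)
  fix P assume "code_at P p (branch p r cb ca)"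
  then have 1: "code_at P p ([JumpZero r (p + length cb + 2)])"
    and 2: "code_at P (p + 1) cb"
    and 3: "code_at P (p + 1 + length cb) [Jump (p + length cb + 2 + length ca)]"
    and 4: "code_at P (p + length cb + 2) ca"
    unfolding branch_def by (auto dest!: code_at_append simp del: append_Cons)
  show "(step P xs ^^ (if R r = 0 then t + 1 else u + 2)) (p, R) =
      (p + length (branch p r cb ca), R')"
  proof (cases "R r = 0")
    case True
    have "(step P xs ^^ 1) (p, R) = (p + length cb + 2, R)"
      using True code_at_step[OF 1] by simp
    moreover have "(step P xs ^^ t) (p + length cb + 2, R) = (p + length cb + 2 + length ca, R')"
      using assms(1)[OF True] 4 by (auto simp: runs_def)
    ultimately have "(step P xs ^^ (1 + t)) (p, R) = (p + length cb + 2 + length ca, R')"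
      by (rule step_add)
    then show ?thesis using True by (simp add: branch_def)
  next
    case False
    have "(step P xs ^^ 1) (p, R) = (p + 1, R)"
      using False code_at_step[OF 1] by simp
    moreover have "(step P xs ^^ u) (p + 1, R) = (p + 1 + length cb, R')"
      using assms(2)[OF False] 2 by (auto simp: runs_def)
    ultimately have "(step P xs ^^ (1 + u)) (p, R) = (p + 1 + length cb, R')"
      by (rule step_add)
    moreover have "(step P xs ^^ 1) (p + 1 + length cb, R') = (p + length cb + 2 + length ca, R')"
      using code_at_step[OF 3] by simp
    ultimately have "(step P xs ^^ (1 + u + 1)) (p, R) = (p + length cb + 2 + length ca, R')"
      by (rule step_add)
    then show ?thesis using False by (simp add: branch_def)
  qed
qed

text \<open>The invariant is indexed by the number of rounds left. Assuming the body only below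
  \<open>N\<close> allows invariants that mention the rounds already done, \<open>N - m\<close>,
  without truncated subtraction getting in the way.\<close>

lemma runs_loop:
  assumes body: "\<And>m R. \<lbrakk>m < N; I (Suc m) R; R r = Suc m\<rbrakk> \<Longrightarrow>
      \<exists>R'. runs xs (p + 3) cb (T m) (R(t := 1, r := m)) R' \<and> I m R' \<and> R' r = m"
    and "r \<noteq> t" "I m R" "R r = m" "m \<le> N"
  shows "\<exists>R'. runs xs p (loop p r t cb) (1 + (\<Sum>i<m. T i + 4)) R R' \<and> I 0 R'"
  using assms(3-)
proof (induction m arbitrary: R)
  case 0
  have "runs xs p (loop p r t cb) 1 R R"
    unfolding runs_def
  proof (intro allI impI)
    fix P assume "code_at P p (loop p r t cb)"
    then show "(step P xs ^^ 1) (p, R) = (p + length (loop p r t cb), R)"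
      using 0 by (simp add: code_at_step loop_def)
  qed
  with 0 show ?case by auto
next
  case (Suc m)
  obtain R1 where R1: "runs xs (p + 3) cb (T m) (R(t := 1, r := m)) R1" "I m R1" "R1 r = m"
    using body[of m R] Suc.prems by auto
  obtain R2 where R2: "runs xs p (loop p r t cb) (1 + (\<Sum>i<m. T i + 4)) R1 R2" "I 0 R2"
    using Suc.IH[of R1] R1 Suc.prems by auto
  have "runs xs p (loop p r t cb) (1 + (\<Sum>i<Suc m. T i + 4)) R R2"
    unfolding runs_def
  proof (intro allI impI)
    fix P assume P: "code_at P p (loop p r t cb)"
    then have 1: "code_at P p [JumpZero r (p + length cb + 4)]"
      and 2: "code_at P (p + 1) [Const t 1]"
      and 3: "code_at P (p + 2) [Sub r r t]"
      and 4: "code_at P (p + 3) cb"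
      and 5: "code_at P (p + 3 + length cb) [Jump p]"
      using code_at_append[of P p "[JumpZero r (p + length cb + 4)]"
          "[Const t 1] @ [Sub r r t] @ cb @ [Jump p]"]
        code_at_append[of P "p + 1" "[Const t 1]" "[Sub r r t] @ cb @ [Jump p]"]
        code_at_append[of P "p + 2" "[Sub r r t]" "cb @ [Jump p]"]
        code_at_append[of P "p + 3" "cb" "[Jump p]"]
      unfolding loop_def by (simp_all add: numeral_3_eq_3)
    have "(step P xs ^^ 1) (p, R) = (p + 1, R)"
      using code_at_step[OF 1] Suc.prems by simp
    moreover have "(step P xs ^^ 1) (p + 1, R) = (p + 2, R(t := 1))"
      using code_at_step[OF 2] by simp
    ultimately have "(step P xs ^^ (1 + 1)) (p, R) = (p + 2, R(t := 1))" by (rule step_add)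
    moreover have "(step P xs ^^ 1) (p + 2, R(t := 1)) = (p + 3, R(t := 1, r := m))"
      using code_at_step[OF 3] Suc.prems \<open>r \<noteq> t\<close> by simp
    ultimately have "(step P xs ^^ (1 + 1 + 1)) (p, R) = (p + 3, R(t := 1, r := m))" by (rule step_add)
    moreover have "(step P xs ^^ T m) (p + 3, R(t := 1, r := m)) = (p + 3 + length cb, R1)"
      using R1 4 by (auto simp: runs_def)
    ultimately have "(step P xs ^^ (1 + 1 + 1 + T m)) (p, R) = (p + 3 + length cb, R1)" by (rule step_add)
    moreover have "(step P xs ^^ 1) (p + 3 + length cb, R1) = (p, R1)"
      using code_at_step[OF 5] by simp
    ultimately have "(step P xs ^^ (1 + 1 + 1 + T m + 1)) (p, R) = (p, R1)" by (rule step_add)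
    moreover have "(step P xs ^^ (1 + (\<Sum>i<m. T i + 4))) (p, R1) = (p + length (loop p r t cb), R2)"
      using R2(1) P by (auto simp: runs_def)
    ultimately have "(step P xs ^^ (1 + 1 + 1 + T m + 1 + (1 + (\<Sum>i<m. T i + 4)))) (p, R) =
       (p + length (loop p r t cb), R2)" by (rule step_add)
    then show "(step P xs ^^ (1 + (\<Sum>i<Suc m. T i + 4))) (p, R) = (p + length (loop p r t cb), R2)"
      by (rule back_subst[where P = "\<lambda>k. (step P xs ^^ k) (p, R) = _"]) simp
  qed
  with R2 show ?case by blast
qed

text \<open>Preserving all registers below \<open>d\<close> carries the induction: variables, a
  pending first operand and loop counters stay intact while a subexpression works higher up, and
  \<open>0 < d\<close> protects the input length.\<close>

lemma compile_correct:
  assumes "\<forall>r\<in>set rs. r < d" "0 < d" "R 0 = length xs" "map R rs = \<rho>"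
  shows "\<exists>R'. runs xs p (compile e p rs d) (cost xs \<rho> e) R R' \<and>
           R' d = eval xs \<rho> e \<and> (\<forall>r<d. R' r = R r)"
  using assms
proof (induction e arbitrary: p rs d R \<rho>)
  case (Var i)
  show ?case
  proof (cases "i < length rs")
    case True
    have "rs ! i < d" using True Var.prems by auto
    moreover have "R (rs ! i) = \<rho> ! i" "i < length \<rho>" using True Var.prems by auto
    ultimately show ?thesis
      using True runs_move[of d "rs ! i" xs p R]
      by (intro exI[of _ "R(d := \<rho> ! i)"]) (simp del: fun_upd_apply, simp)
  next
    case False
    then have "\<not> i < length \<rho>" using Var.prems by auto
    have "runs xs p ([Const d 0] @ [Const d 0]) (1 + 1) R (R(d := 0))"
      by (rule runs_append[of _ _ _ _ _ "R(d := 0)"]; rule runs_single) auto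
    then show ?thesis using False \<open>\<not> i < length \<rho>\<close>
      by (intro exI[of _ "R(d := 0)"]) (simp add: numeral_2_eq_2 del: fun_upd_apply, simp)
  qed
next
  case (Num c)
  show ?case using runs_single[of xs "Const d c" p R "R(d := c)"]
    by (intro exI[of _ "R(d := c)"]) (simp del: fun_upd_apply, simp)
next
  case Len
  then show ?case using runs_move[of d 0 xs p R]
    by (intro exI[of _ "R(d := R 0)"]) (simp del: fun_upd_apply, simp)
next
  case (Plus a b)
  define ca where "ca = compile a p rs d"
  define cb where "cb = compile b (p + length ca) rs (d + 1)"
  obtain R1 where R1: "runs xs p ca (cost xs \<rho> a) R R1" "R1 d = eval xs \<rho> a" "\<forall>r<d. R1 r = R r"
    using Plus.IH(1)[OF Plus.prems] unfolding ca_def by blast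
  have pre: "\<forall>r\<in>set rs. r < d + 1" "0 < d + 1" "R1 0 = length xs" "map R1 rs = \<rho>"
    using Plus.prems R1(3) by auto
  obtain R2 where R2: "runs xs (p + length ca) cb (cost xs \<rho> b) R1 R2"
      "R2 (d + 1) = eval xs \<rho> b" "\<forall>r<d+1. R2 r = R1 r"
    using Plus.IH(2)[OF pre] unfolding cb_def by blast
  define R3 where "R3 = R2(d := R2 d + R2 (d + 1))"
  have "runs xs p ((ca @ cb) @ [Add d d (d + 1)]) (cost xs \<rho> a + cost xs \<rho> b + 1) R R3"
    using runs_append[OF R1(1) R2(1)] by (rule runs_append) (intro runs_single, simp add: R3_def)
  moreover have "R3 d = eval xs \<rho> (Plus a b)" "\<forall>r<d. R3 r = R r"
    using R1 R2 by (auto simp: R3_def)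
  ultimately show ?case by (intro exI[of _ R3]) (simp add: ca_def cb_def Let_def)
next
  case (Minus a b)
  define ca where "ca = compile a p rs d"
  define cb where "cb = compile b (p + length ca) rs (d + 1)"
  obtain R1 where R1: "runs xs p ca (cost xs \<rho> a) R R1" "R1 d = eval xs \<rho> a" "\<forall>r<d. R1 r = R r"
    using Minus.IH(1)[OF Minus.prems] unfolding ca_def by blast
  have pre: "\<forall>r\<in>set rs. r < d + 1" "0 < d + 1" "R1 0 = length xs" "map R1 rs = \<rho>"
    using Minus.prems R1(3) by auto
  obtain R2 where R2: "runs xs (p + length ca) cb (cost xs \<rho> b) R1 R2"
      "R2 (d + 1) = eval xs \<rho> b" "\<forall>r<d+1. R2 r = R1 r"
    using Minus.IH(2)[OF pre] unfolding cb_def by blast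
  define R3 where "R3 = R2(d := R2 d - R2 (d + 1))"
  have "runs xs p ((ca @ cb) @ [Sub d d (d + 1)]) (cost xs \<rho> a + cost xs \<rho> b + 1) R R3"
    using runs_append[OF R1(1) R2(1)] by (rule runs_append) (intro runs_single, simp add: R3_def)
  moreover have "R3 d = eval xs \<rho> (Minus a b)" "\<forall>r<d. R3 r = R r"
    using R1 R2 by (auto simp: R3_def)
  ultimately show ?case by (intro exI[of _ R3]) (simp add: ca_def cb_def Let_def)
next
  case (Halve a)
  obtain R1 where R1: "runs xs p (compile a p rs d) (cost xs \<rho> a) R R1" "R1 d = eval xs \<rho> a"
      "\<forall>r<d. R1 r = R r"
    using Halve.IH[OF Halve.prems] by blast
  define R2 where "R2 = R1(d := R1 d div 2)"
  have "runs xs p (compile a p rs d @ [Half d d]) (cost xs \<rho> a + 1) R R2"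
    using R1(1) by (rule runs_append) (intro runs_single, simp add: R2_def)
  moreover have "R2 d = eval xs \<rho> (Halve a)" "\<forall>r<d. R2 r = R r"
    using R1  by (auto simp: R2_def)
  ultimately show ?case by (intro exI[of _ R2]) simp
next
  case (Inp a)
  obtain R1 where R1: "runs xs p (compile a p rs d) (cost xs \<rho> a) R R1" "R1 d = eval xs \<rho> a"
      "\<forall>r<d. R1 r = R r"
    using Inp.IH[OF Inp.prems] by blast
  define R2 where "R2 = R1(d := if R1 d < length xs then xs ! R1 d else 0)"
  have "runs xs p (compile a p rs d @ [Read d d]) (cost xs \<rho> a + 1) R R2"
    using R1(1) by (rule runs_append) (intro runs_single, simp add: R2_def)
  moreover have "R2 d = eval xs \<rho> (Inp a)" "\<forall>r<d. R2 r = R r"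
    using R1  by (auto simp: R2_def)
  ultimately show ?case by (intro exI[of _ R2]) simp
next
  case (Ifz c a b)
  define cc where "cc = compile c p rs d"
  define q where "q = p + length cc"
  define cb where "cb = compile b (q + 1) rs d"
  define ca where "ca = compile a (q + length cb + 2) rs d"
  obtain R1 where R1: "runs xs p cc (cost xs \<rho> c) R R1" "R1 d = eval xs \<rho> c" "\<forall>r<d. R1 r = R r"
    using Ifz.IH(1)[OF Ifz.prems] unfolding cc_def by blast
  have pre: "\<forall>r\<in>set rs. r < d" "0 < d" "R1 0 = length xs" "map R1 rs = \<rho>"
    using Ifz.prems R1(3) by auto
  obtain Ra where Ra: "runs xs (q + length cb + 2) ca (cost xs \<rho> a) R1 Ra"
      "Ra d = eval xs \<rho> a" "\<forall>r<d. Ra r = R1 r"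
    using Ifz.IH(2)[OF pre] unfolding ca_def by blast
  obtain Rb where Rb: "runs xs (q + 1) cb (cost xs \<rho> b) R1 Rb"
      "Rb d = eval xs \<rho> b" "\<forall>r<d. Rb r = R1 r"
    using Ifz.IH(3)[OF pre] unfolding cb_def by blast
  define R2 where "R2 = (if R1 d = 0 then Ra else Rb)"
  have "runs xs q (branch q d cb ca) (if R1 d = 0 then cost xs \<rho> a + 1 else cost xs \<rho> b + 2) R1 R2"
    by (rule runs_branch) (use Ra Rb in \<open>auto simp: R2_def\<close>)
  then have "runs xs p (cc @ branch q d cb ca) (cost xs \<rho> (Ifz c a b)) R R2"
    using runs_append[OF R1(1)] R1(2) by (simp add: q_def)
  moreover have "R2 d = eval xs \<rho> (Ifz c a b)" "\<forall>r<d. R2 r = R r"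
    using R1 Ra Rb by (auto simp: R2_def)
  ultimately show ?case by (intro exI[of _ R2]) (simp add: cc_def ca_def cb_def q_def Let_def)
next
  case (Bind a b)
  define ca where "ca = compile a p rs d"
  define cb where "cb = compile b (p + length ca) (d # rs) (d + 1)"
  obtain R1 where R1: "runs xs p ca (cost xs \<rho> a) R R1" "R1 d = eval xs \<rho> a" "\<forall>r<d. R1 r = R r"
    using Bind.IH(1)[OF Bind.prems] unfolding ca_def by blast
  have pre: "\<forall>r\<in>set (d # rs). r < d + 1" "0 < d + 1" "R1 0 = length xs"
      "map R1 (d # rs) = eval xs \<rho> a # \<rho>"
    using Bind.prems R1(2,3) by auto
  obtain R2 where R2: "runs xs (p + length ca) cb (cost xs (eval xs \<rho> a # \<rho>) b) R1 R2"
      "R2 (d + 1) = eval xs (eval xs \<rho> a # \<rho>) b" "\<forall>r<d+1. R2 r = R1 r"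
    using Bind.IH(2)[OF pre] unfolding cb_def by blast
  define R3 where "R3 = R2(d := R2 (d + 1))"
  have "runs xs p (ca @ (cb @ move d (d + 1)))
      (cost xs \<rho> a + (cost xs (eval xs \<rho> a # \<rho>) b + 2)) R R3"
    by (intro runs_append[OF R1(1)] runs_append[OF R2(1)]) (auto intro: runs_move simp: R3_def)
  moreover have "R3 d = eval xs \<rho> (Bind a b)" "\<forall>r<d. R3 r = R r"
    using R1 R2 by (auto simp: R3_def)
  ultimately show ?case by (intro exI[of _ R3]) (simp add: ca_def cb_def Let_def)
next
  case (Sum m b)
  define cm where "cm = compile m (p + 1) rs (d + 1)"
  define q where "q = p + 1 + length cm"
  define cb where "cb = compile b (q + 3) ((d + 1) # rs) (d + 2)"
  define F where "F i = eval xs (i # \<rho>) b" for i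
  define N where "N = eval xs \<rho> m"
  have pre: "\<forall>r\<in>set rs. r < d + 1" "0 < d + 1" "(R(d := 0)) 0 = length xs" "map (R(d := 0)) rs = \<rho>"
    using Sum.prems by auto
  obtain R1 where R1: "runs xs (p + 1) cm (cost xs \<rho> m) (R(d := 0)) R1" "R1 (d + 1) = N"
      "\<forall>r<d+1. R1 r = (R(d := 0)) r"
    using Sum.IH(1)[OF pre] unfolding cm_def N_def by blast
  \<comment> \<open>The counter falls, so the accumulator collects the summands from the last one
    down.\<close>
  define I where "I j R' \<longleftrightarrow> R' d = (\<Sum>i=j..<N. F i) \<and> (\<forall>r<d. R' r = R r)" for j and R' :: "nat \<Rightarrow> nat"
  have "\<exists>R'. runs xs q (loop q (d + 1) (d + 2) (cb @ [Add d d (d + 2)]))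
      (1 + (\<Sum>i<N. (cost xs (i # \<rho>) b + 1) + 4)) R1 R' \<and> I 0 R'"
  proof (rule runs_loop[where I = I and N = N])
    fix j S assume S: "j < N" "I (Suc j) S" "S (d + 1) = Suc j"
    define S0 where "S0 = S(d + 2 := 1, d + 1 := j)"
    have "S 0 = length xs" "map S rs = \<rho>"
      using S(2) Sum.prems by (auto simp: I_def)
    moreover have "d \<notin> set rs" "Suc d \<notin> set rs" "Suc (Suc d) \<notin> set rs"
      using Sum.prems(1) by fastforce+
    ultimately have pre: "\<forall>r\<in>set ((d + 1) # rs). r < d + 2" "0 < d + 2" "S0 0 = length xs"
      "map S0 ((d + 1) # rs) = j # \<rho>"
      using Sum.prems by (auto simp: S0_def)
    obtain S1 where S1: "runs xs (q + 3) cb (cost xs (j # \<rho>) b) S0 S1"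
      "S1 (d + 2) = F j" "\<forall>r<d+2. S1 r = S0 r"
      using Sum.IH(2)[OF pre] unfolding cb_def F_def by blast
    define S2 where "S2 = S1(d := S1 d + S1 (d + 2))"
    have "runs xs (q + 3) (cb @ [Add d d (d + 2)]) (cost xs (j # \<rho>) b + 1) S0 S2"
      by (intro runs_append[OF S1(1)] runs_single) (simp add: S2_def)
    moreover have "I j S2" "S2 (d + 1) = j"
      using S S1(2,3) by (auto simp: I_def S2_def S0_def sum.atLeast_Suc_lessThan)
    ultimately show "\<exists>R'. runs xs (q + 3) (cb @ [Add d d (d + 2)]) (cost xs (j # \<rho>) b + 1)
        (S(d + 2 := 1, d + 1 := j)) R' \<and> I j R' \<and> R' (d + 1) = j"
      unfolding S0_def by blast
  qed (use R1 in \<open>auto simp: I_def\<close>)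
  then obtain R2 where R2: "runs xs q (loop q (d + 1) (d + 2) (cb @ [Add d d (d + 2)]))
      (1 + (\<Sum>i<N. (cost xs (i # \<rho>) b + 1) + 4)) R1 R2" "I 0 R2"
    by blast
  have 1: "runs xs p [Const d 0] 1 R (R(d := 0))"
    by (rule runs_single) simp
  have 2: "runs xs (p + length [Const d 0]) (cm @ loop q (d + 1) (d + 2) (cb @ [Add d d (d + 2)]))
      (cost xs \<rho> m + (1 + (\<Sum>i<N. (cost xs (i # \<rho>) b + 1) + 4))) (R(d := 0)) R2"
    using runs_append[OF R1(1) R2(1)[unfolded q_def]] by (simp add: q_def)
  have "runs xs p (compile (Sum m b) p rs d) (cost xs \<rho> (Sum m b)) R R2"
    using runs_append[OF 1 2] by (simp add: Let_def cm_def q_def cb_def N_def)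
  then show ?case using R2(2)
    by (intro exI[of _ R2]) (auto simp: I_def F_def N_def atLeast0LessThan)
next
  case (Iter m a b)
  define ca where "ca = compile a p rs d"
  define cm where "cm = compile m (p + length ca) rs (d + 1)"
  define q where "q = p + length ca + length cm"
  define cb where "cb = compile b (q + 3) (d # rs) (d + 2)"
  define F where "F y = eval xs (y # \<rho>) b" for y
  define N where "N = eval xs \<rho> m"
  define z where "z = eval xs \<rho> a"
  obtain R0 where R0: "runs xs p ca (cost xs \<rho> a) R R0" "R0 d = z" "\<forall>r<d. R0 r = R r"
    using Iter.IH(2)[OF Iter.prems] unfolding ca_def z_def by blast
  have pre: "\<forall>r\<in>set rs. r < d + 1" "0 < d + 1" "R0 0 = length xs" "map R0 rs = \<rho>"
    using Iter.prems R0(3) by auto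
  obtain R1 where R1: "runs xs (p + length ca) cm (cost xs \<rho> m) R0 R1" "R1 (d + 1) = N"
      "\<forall>r<d+1. R1 r = R0 r"
    using Iter.IH(1)[OF pre] unfolding cm_def N_def by blast
  \<comment> \<open>With \<open>j\<close> rounds left, \<open>N - j\<close> updates have been
    made.\<close>
  define I where "I j R' \<longleftrightarrow> R' d = (F ^^ (N - j)) z \<and> (\<forall>r<d. R' r = R r)" for j and R' :: "nat \<Rightarrow> nat"
  have "\<exists>R'. runs xs q (loop q (d + 1) (d + 2) (cb @ move d (d + 2)))
      (1 + (\<Sum>i<N. (cost xs ((F ^^ (N - Suc i)) z # \<rho>) b + 2) + 4)) R1 R' \<and> I 0 R'"
  proof (rule runs_loop[where I = I and N = N])
    fix j S assume S: "j < N" "I (Suc j) S" "S (d + 1) = Suc j"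
    define S0 where "S0 = S(d + 2 := 1, d + 1 := j)"
    have "S 0 = length xs" "map S rs = \<rho>"
      using S(2) Iter.prems by (auto simp: I_def)
    moreover have "d \<notin> set rs" "Suc d \<notin> set rs" "Suc (Suc d) \<notin> set rs"
      using Iter.prems(1) by fastforce+
    ultimately have pre: "\<forall>r\<in>set (d # rs). r < d + 2" "0 < d + 2" "S0 0 = length xs"
      "map S0 (d # rs) = (F ^^ (N - Suc j)) z # \<rho>"
      using Iter.prems S(2) by (auto simp: S0_def I_def)
    obtain S1 where S1: "runs xs (q + 3) cb (cost xs ((F ^^ (N - Suc j)) z # \<rho>) b) S0 S1"
      "S1 (d + 2) = F ((F ^^ (N - Suc j)) z)" "\<forall>r<d+2. S1 r = S0 r"
      using Iter.IH(3)[OF pre] unfolding cb_def F_def by blast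
    define S2 where "S2 = S1(d := S1 (d + 2))"
    have "runs xs (q + 3) (cb @ move d (d + 2)) (cost xs ((F ^^ (N - Suc j)) z # \<rho>) b + 2) S0 S2"
      unfolding S2_def by (intro runs_append[OF S1(1)] runs_move) simp
    moreover have "F ((F ^^ (N - Suc j)) z) = (F ^^ (N - j)) z"
      using S(1) by (metis Suc_diff_Suc funpow.simps(2) o_apply)
    then have "I j S2" "S2 (d + 1) = j"
      using S S1(2,3) by (auto simp: I_def S2_def S0_def)
    ultimately show "\<exists>R'. runs xs (q + 3) (cb @ move d (d + 2))
        (cost xs ((F ^^ (N - Suc j)) z # \<rho>) b + 2)
        (S(d + 2 := 1, d + 1 := j)) R' \<and> I j R' \<and> R' (d + 1) = j"
      unfolding S0_def by blast
  qed (use R0 R1 in \<open>auto simp: I_def\<close>)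
  then obtain R2 where R2: "runs xs q (loop q (d + 1) (d + 2) (cb @ move d (d + 2)))
      (1 + (\<Sum>i<N. (cost xs ((F ^^ (N - Suc i)) z # \<rho>) b + 2) + 4)) R1 R2" "I 0 R2"
    by blast
  have "runs xs p (compile (Iter m a b) p rs d) (cost xs \<rho> (Iter m a b)) R R2"
    using runs_append[OF R0(1) runs_append[OF R1(1) R2(1)[unfolded q_def]]]
    by (simp add: Let_def ca_def cm_def q_def cb_def N_def z_def F_def[abs_def])
  then show ?case using R2(2)
    by (intro exI[of _ R2]) (auto simp: I_def F_def[abs_def] N_def z_def)
qed

text \<open>The result is built in register 1, as register 0 must hold the input length until the
  final \<open>move\<close>.\<close>

definition program :: "exp \<Rightarrow> instr list" where
  "program e = compile e 0 [] 1 @ move 0 1"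

lemma outputs_within_mono:
  assumes "outputs_within P xs t y" "t \<le> u"
  shows "outputs_within P xs u y"
proof -
  obtain pc R where 1: "(step P xs ^^ t) (init_config xs) = (pc, R)" "length P \<le> pc" "R 0 = y"
    using assms(1) unfolding outputs_within_def by blast
  have "(step P xs ^^ s) (pc, R) = (pc, R)" for s
    using 1(2) by (induction s) (auto simp: step_def)
  from step_add[OF 1(1) this[of "u - t"]] assms(2) 1(2,3) show ?thesis
    unfolding outputs_within_def by auto
qed

lemma program_outputs: "outputs_within (program e) xs (cost xs [] e + 2) (eval xs [] e)"
proof -
  let ?R = "(\<lambda>_. 0)(0 := length xs)"
  obtain R' where R': "runs xs 0 (compile e 0 [] 1) (cost xs [] e) ?R R'" "R' 1 = eval xs [] e"
    using compile_correct[of "[]" 1 ?R xs "[]" 0 e] by auto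
  have "runs xs 0 (program e) (cost xs [] e + 2) ?R (R'(0 := R' 1))"
    unfolding program_def by (intro runs_append[OF R'(1)] runs_move) simp
  moreover have "code_at (program e) 0 (program e)"
    by (auto simp: code_at_def)
  ultimately show ?thesis using R'(2) by (auto simp: runs_def outputs_within_def init_config_def)
qed

section \<open>Expressions of polynomial cost\<close>

definition Clip :: "exp \<Rightarrow> exp" where
  "Clip e = Ifz (Minus e Len) e Len"

lemma eval_Clip [simp]: "eval xs \<rho> (Clip e) = min (eval xs \<rho> e) (length xs)"
  by (auto simp: Clip_def)

text \<open>Loops clipped at the input length are what makes the cost polynomial, whatever the environment.\<close>

primrec clipped :: "exp \<Rightarrow> bool" where
  "clipped (Var i) = True"
| "clipped (Num c) = True"
| "clipped Len = True"
| "clipped (Plus a b) = (clipped a \<and> clipped b)"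
| "clipped (Minus a b) = (clipped a \<and> clipped b)"
| "clipped (Halve a) = clipped a"
| "clipped (Inp a) = clipped a"
| "clipped (Ifz c a b) = (clipped c \<and> clipped a \<and> clipped b)"
| "clipped (Bind a b) = (clipped a \<and> clipped b)"
| "clipped (Sum m b) = (m \<in> range Clip \<and> clipped m \<and> clipped b)"
| "clipped (Iter m a b) = (m \<in> range Clip \<and> clipped m \<and> clipped a \<and> clipped b)"

lemma clipped_Clip [simp]: "clipped (Clip e) = clipped e"
  by (auto simp: Clip_def)

text \<open>Uniformity in the environment matters: one of its entries will be the guess, which can
  be exponential in the square of the parameter.\<close>

lemma clipped_cost_poly:
  "clipped e \<Longrightarrow> \<exists>p :: nat poly. \<forall>xs \<rho>. cost xs \<rho> e \<le> poly p (length xs)"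
proof (induction e)
  case (Var i) show ?case by (intro exI[of _ "[:2:]"]) auto
next
  case (Num c) show ?case by (intro exI[of _ "[:1:]"]) auto
next
  case Len show ?case by (intro exI[of _ "[:2:]"]) auto
next
  case (Plus a b)
  then obtain p q :: "nat poly" where
    "\<forall>xs \<rho>. cost xs \<rho> a \<le> poly p (length xs)"
    "\<forall>xs \<rho>. cost xs \<rho> b \<le> poly q (length xs)"
    by auto
  then show ?case by (intro exI[of _ "p + q + 1"]) (auto intro: add_mono)
next
  case (Minus a b)
  then obtain p q :: "nat poly" where
    "\<forall>xs \<rho>. cost xs \<rho> a \<le> poly p (length xs)"
    "\<forall>xs \<rho>. cost xs \<rho> b \<le> poly q (length xs)"
    by auto
  then show ?case by (intro exI[of _ "p + q + 1"]) (auto intro: add_mono)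
next
  case (Halve a)
  then obtain p :: "nat poly" where "\<forall>xs \<rho>. cost xs \<rho> a \<le> poly p (length xs)" by auto
  then show ?case by (intro exI[of _ "p + 1"]) auto
next
  case (Inp a)
  then obtain p :: "nat poly" where "\<forall>xs \<rho>. cost xs \<rho> a \<le> poly p (length xs)" by auto
  then show ?case by (intro exI[of _ "p + 1"]) auto
next
  case (Ifz c a b)
  then obtain p q r :: "nat poly" where
    *: "\<forall>xs \<rho>. cost xs \<rho> a \<le> poly p (length xs)"
    "\<forall>xs \<rho>. cost xs \<rho> b \<le> poly q (length xs)"
    "\<forall>xs \<rho>. cost xs \<rho> c \<le> poly r (length xs)"
    by auto
  show ?case
  proof (intro exI[of _ "p + q + r + [:2:]"] allI)
    fix xs \<rho>
    show "cost xs \<rho> (Ifz c a b) \<le> poly (p + q + r + [:2:]) (length xs)"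
      using *[rule_format, of xs \<rho>] by auto
  qed
next
  case (Bind a b)
  then obtain p q :: "nat poly" where
    "\<forall>xs \<rho>. cost xs \<rho> a \<le> poly p (length xs)"
    "\<forall>xs \<rho>. cost xs \<rho> b \<le> poly q (length xs)"
    by auto
  then show ?case by (intro exI[of _ "p + q + [:2:]"]) (auto intro!: add_mono)
next
  case (Sum m b)
  then obtain p q :: "nat poly" where
    *: "\<forall>xs \<rho>. cost xs \<rho> m \<le> poly p (length xs)"
    "\<forall>xs \<rho>. cost xs \<rho> b \<le> poly q (length xs)"
    by auto
  obtain e where m: "m = Clip e" using Sum.prems by auto
  show ?case
  proof (intro exI[of _ "p + [:0, 1:] * (q + [:5:]) + [:2:]"] allI)
    fix xs \<rho>
    have "(\<Sum>i<eval xs \<rho> m. cost xs (i # \<rho>) b + 1 + 4) \<le> (\<Sum>i<eval xs \<rho> m. poly q (length xs) + 5)"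
      using * by (intro sum_mono) auto
    also have "\<dots> \<le> length xs * (poly q (length xs) + 5)" unfolding m by simp
    finally show "cost xs \<rho> (Sum m b) \<le> poly (p + [:0, 1:] * (q + [:5:]) + [:2:]) (length xs)"
      using *(1)[rule_format, of xs \<rho>] by (simp add: algebra_simps)
  qed
next
  case (Iter m a b)
  then obtain p q r :: "nat poly" where
    *: "\<forall>xs \<rho>. cost xs \<rho> m \<le> poly p (length xs)"
    "\<forall>xs \<rho>. cost xs \<rho> b \<le> poly q (length xs)"
    "\<forall>xs \<rho>. cost xs \<rho> a \<le> poly r (length xs)"
    by auto
  obtain e where m: "m = Clip e" using Iter.prems by auto
  show ?case
  proof (intro exI[of _ "r + p + [:0, 1:] * (q + [:6:]) + [:1:]"] allI)
    fix xs \<rho>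
    have "(\<Sum>i<eval xs \<rho> m. cost xs (((\<lambda>y. eval xs (y # \<rho>) b) ^^ (eval xs \<rho> m - Suc i)) (eval xs \<rho> a) # \<rho>) b + 2 + 4)
       \<le> (\<Sum>i<eval xs \<rho> m. poly q (length xs) + 6)"
      using * by (intro sum_mono) auto
    also have "\<dots> \<le> length xs * (poly q (length xs) + 6)" unfolding m by simp
    finally show "cost xs \<rho> (Iter m a b) \<le> poly (r + p + [:0, 1:] * (q + [:6:]) + [:1:]) (length xs)"
      using *(1)[rule_format, of xs \<rho>] *(3)[rule_format, of xs \<rho>] by (simp add: algebra_simps)
  qed
qed

lemma poly_nat_mono: "x \<le> y \<Longrightarrow> poly (p :: nat poly) x \<le> poly p y"
  by (induction p) (auto intro!: add_mono mult_mono)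

text \<open>Each entry contributes at least its separator.\<close>

lemma length_le_input_size: "length xs \<le> input_size xs"
  by (induction xs) (auto simp: input_size_def)

section \<open>A normal form for solutions\<close>

text \<open>Greedy choice: take elements in decreasing order of \<open>key\<close>. Distinct keys
  keep the set closed upwards at each size, and a competitor with one element more than the current
  set has an element outside it, which weighs at most as much as the next one taken.\<close>

lemma exists_upset_dominating:
  fixes key wt :: "'a \<Rightarrow> nat"
  assumes "finite X" "inj_on key X"
    and mono: "\<And>x y. x \<in> X \<Longrightarrow> y \<in> X \<Longrightarrow> key x \<le> key y \<Longrightarrow> wt x \<le> wt y"
    and "m \<le> card X"
  shows "\<exists>U\<subseteq>X. (U = {} \<or> (\<exists>t\<in>X. U = {v \<in> X. key t \<le> key v})) \<and> card U = m \<and>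
     (\<forall>A\<subseteq>X. card A = m \<longrightarrow> sum wt A \<le> sum wt U)"
  using \<open>m \<le> card X\<close>
proof (induction m)
  case 0
  show ?case using finite_subset[OF _ \<open>finite X\<close>] by (intro exI[of _ "{}"]) auto
next
  case (Suc m)
  then obtain U where U: "U \<subseteq> X" "U = {} \<or> (\<exists>t\<in>X. U = {v \<in> X. key t \<le> key v})" "card U = m"
    and opt: "\<And>A. A \<subseteq> X \<Longrightarrow> card A = m \<Longrightarrow> sum wt A \<le> sum wt U" by auto
  have fU: "finite U" using U(1) \<open>finite X\<close> finite_subset by blast
  have "U \<noteq> X" using U(3) Suc.prems by auto
  then have ne: "X - U \<noteq> {}" using U(1) by auto
  have fin: "finite (key ` (X - U))" using \<open>finite X\<close> by auto
  have "Max (key ` (X - U)) \<in> key ` (X - U)" using ne fin by (intro Max_in) auto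
  then obtain x where x: "x \<in> X" "x \<notin> U" "key x = Max (key ` (X - U))" by auto
  have max: "key y \<le> key x" if "y \<in> X" "y \<notin> U" for y
    unfolding x(3) using that fin by (intro Max_ge) auto
  have "insert x U = {v \<in> X. key x \<le> key v}"
  proof (intro equalityI subsetI)
    fix v assume v: "v \<in> insert x U"
    show "v \<in> {v \<in> X. key x \<le> key v}"
    proof (cases "v = x")
      case False
      then have "v \<in> U" using v by simp
      then obtain t where t: "U = {v \<in> X. key t \<le> key v}" using U(2) by blast
      have "key x < key t" using x(1,2) unfolding t by simp
      then show ?thesis using \<open>v \<in> U\<close> unfolding t by simp
    qed (use x(1) in simp)
  next
    fix v assume v: "v \<in> {v \<in> X. key x \<le> key v}"
    then show "v \<in> insert x U"
      using max[of v] \<open>inj_on key X\<close> x(1) by (auto dest: inj_onD)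
  qed
  moreover have "sum wt A \<le> sum wt (insert x U)" if A: "A \<subseteq> X" "card A = Suc m" for A
  proof -
    have fA: "finite A" using A(1) \<open>finite X\<close> finite_subset by blast
    have "\<not> A \<subseteq> U" using card_mono[OF fU, of A] A(2) U(3) by auto
    then obtain a where a: "a \<in> A" "a \<notin> U" by auto
    have "sum wt A = wt a + sum wt (A - {a})" using a(1) fA by (simp add: sum.remove)
    also have "\<dots> \<le> wt x + sum wt U"
      using A a max[of a] mono[of a x] x(1) opt[of "A - {a}"] fA by (intro add_mono) auto
    finally show ?thesis using x(2) fU by simp
  qed
  moreover have "card (insert x U) = Suc m" "insert x U \<subseteq> X"
    using x(1,2) fU U(1,3) by auto
  ultimately show ?case using x(1) by (intro exI[of _ "insert x U"]) blast
qed

section \<open>Weighted degrees, pendants and the core\<close>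

locale wgraph =
  fixes n :: nat and E :: "nat set set" and w :: "nat set \<Rightarrow> nat"
  assumes wgraph: "weighted_graph {..<n} E w"
begin

definition wt :: "nat \<Rightarrow> nat \<Rightarrow> nat" where
  "wt u v = (if {u, v} \<in> E then w {u, v} else 0)"

abbreviation deg :: "nat \<Rightarrow> nat" where "deg \<equiv> degree_in E"

definition wdeg :: "nat \<Rightarrow> nat" where
  "wdeg v = (\<Sum>u<n. wt v u)"

text \<open>Weighted degree with ties broken by the vertex number, for vertices below \<open>n\<close>.\<close>

definition key :: "nat \<Rightarrow> nat" where
  "key v = n * wdeg v + v"

definition pendant :: "nat \<Rightarrow> nat \<Rightarrow> bool" where
  "pendant v h \<longleftrightarrow> {v, h} \<in> E \<and> deg v = 1 \<and> 2 \<le> deg h"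

definition core :: "nat \<Rightarrow> bool" where
  "core v \<longleftrightarrow> v < n \<and> (2 \<le> deg v \<or> (\<exists>h. pendant v h \<and> (\<forall>v'. pendant v' h \<longrightarrow> key v' \<le> key v)))"

definition iso_edge :: "nat \<Rightarrow> nat \<Rightarrow> bool" where
  "iso_edge u v \<longleftrightarrow> {u, v} \<in> E \<and> deg u = 1 \<and> deg v = 1"

lemma edge_ends: "{u, v} \<in> E \<Longrightarrow> u < n \<and> v < n \<and> u \<noteq> v"
  using wgraph unfolding weighted_graph_def simple_graph_def
  by (metis doubleton_eq_iff insert_absorb2 lessThan_iff)

lemma edge_cases:
  assumes "e \<in> E"
  obtains u v where "e = {u, v}" "u < v"
  using assms wgraph unfolding weighted_graph_def simple_graph_def
  by (metis insert_commute linorder_neqE_nat)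

lemma edge_eq:
  assumes "e \<in> E" "x \<in> e" "y \<in> e" "x \<noteq> y"
  shows "e = {x, y}"
  using edge_cases[OF assms(1)] assms(2-4) by blast

lemma edge_at:
  assumes "e \<in> E" "x \<in> e"
  obtains y where "e = {x, y}"
  using edge_cases[OF assms(1)] assms(2) by blast

lemma finite_E: "finite E"
proof (rule finite_subset)
  show "E \<subseteq> Pow {..<n}"
    using edge_cases edge_ends by (metis PowI empty_subsetI insert_subset lessThan_iff subsetI)
qed auto

lemma wt_pos_iff: "0 < wt u v \<longleftrightarrow> {u, v} \<in> E"
  using wgraph by (auto simp: wt_def weighted_graph_def)

text \<open>Lets degrees be computed by counting vertices instead of edges.\<close>

lemma deg_card: "deg v = card {u. u < n \<and> {v, u} \<in> E}"
proof -
  have "{e \<in> E. v \<in> e} = (\<lambda>u. {v, u}) ` {u. u < n \<and> {v, u} \<in> E}"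
  proof (intro equalityI subsetI)
    fix e assume e: "e \<in> {e \<in> E. v \<in> e}"
    then obtain a b where "e = {a, b}" using edge_cases by blast
    with e have "e = {v, a} \<or> e = {v, b}" by auto
    then show "e \<in> (\<lambda>u. {v, u}) ` {u. u < n \<and> {v, u} \<in> E}" using e edge_ends by auto
  qed auto
  moreover have "inj_on (\<lambda>u. {v, u}) {u. u < n \<and> {v, u} \<in> E}"
    by (auto simp: inj_on_def doubleton_eq_iff)
  ultimately show ?thesis by (simp add: degree_in_def card_image)
qed

lemma deg_1_edge_unique:
  assumes "deg v = 1" "e \<in> E" "e' \<in> E" "v \<in> e" "v \<in> e'"
  shows "e = e'"
proof -
  obtain e0 where e0: "{e \<in> E. v \<in> e} = {e0}"
    using assms(1) card_1_singletonE unfolding degree_in_def by blast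
  have "e \<in> {e \<in> E. v \<in> e}" "e' \<in> {e \<in> E. v \<in> e}" using assms by auto
  then show ?thesis unfolding e0 by simp
qed

lemma nbr_unique:
  assumes "deg v = 1" "{v, u} \<in> E" "{v, u'} \<in> E"
  shows "u' = u"
proof -
  have "{v, u} = {v, u'}" using deg_1_edge_unique[OF assms(1-3)] by simp
  then show ?thesis by (auto simp: doubleton_eq_iff)
qed

lemma deg_pos:
  assumes "{u, v} \<in> E"
  shows "0 < deg u"
proof -
  have "{e \<in> E. u \<in> e} \<noteq> {}" using assms by blast
  then show ?thesis using finite_E by (simp add: degree_in_def card_gt_0_iff)
qed

lemma deg_cases: "{u, v} \<in> E \<Longrightarrow> deg u = 1 \<or> 2 \<le> deg u"
  using deg_pos[of u v] by linarith

text \<open>This is why a single order by weighted degree ranks pendant edges and isolated edges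
  alike by their weight.\<close>

lemma wdeg_deg_1:
  assumes "deg v = 1" "{v, u} \<in> E"
  shows "wdeg v = w {v, u}"
proof -
  have "wt v u' = (if u' = u then w {v, u} else 0)" for u'
    using nbr_unique[OF assms, of u'] assms(2) by (cases "u' = u") (auto simp: wt_def)
  then show ?thesis using edge_ends[OF assms(2)] by (simp add: wdeg_def)
qed

text \<open>A difference of 1 in \<open>wdeg\<close> is worth \<open>n\<close> in
  \<open>key\<close>, more than the vertex numbers can make up for.\<close>

lemma key_mono: "key x \<le> key y \<Longrightarrow> x < n \<Longrightarrow> y < n \<Longrightarrow> wdeg x \<le> wdeg y"
proof (rule ccontr)
  assume *: "key x \<le> key y" "y < n" "\<not> wdeg x \<le> wdeg y"
  then have "n * (wdeg y + 1) \<le> n * wdeg x" by (intro mult_left_mono) auto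
  with * show False by (simp add: key_def)
qed

lemma inj_on_key: "inj_on key {..<n}"
proof (rule inj_onI)
  fix x y assume *: "x \<in> {..<n}" "y \<in> {..<n}" "key x = key y"
  then have "wdeg x = wdeg y" using key_mono by (intro antisym) auto
  with * show "x = y" by (simp add: key_def)
qed

lemma pendant_lt: "pendant v h \<Longrightarrow> v < n \<and> h < n"
  by (auto simp: pendant_def dest: edge_ends)

lemma pendant_unique: "pendant v h \<Longrightarrow> pendant v h' \<Longrightarrow> h = h'"
  using nbr_unique[of v h h'] by (simp add: pendant_def)

lemma obtain_core_pendant:
  assumes "pendant v h"
  obtains b where "pendant b h" "core b" "key v \<le> key b"
proof -
  let ?X = "{v. pendant v h}"
  have "?X \<subseteq> {..<n}" using pendant_lt by blast
  then have f: "finite (key ` ?X)" using finite_subset by blast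
  have "Max (key ` ?X) \<in> key ` ?X" using assms f by (intro Max_in) auto
  then obtain b where b: "pendant b h" "key b = Max (key ` ?X)" by auto
  have max: "key v' \<le> key b" if "pendant v' h" for v'
    unfolding b(2) using that f by (intro Max_ge) auto
  have "core b" unfolding core_def using b(1) max pendant_lt by blast
  then show ?thesis using that b(1) max[OF assms] by blast
qed

text \<open>Distinct keys leave at most one core pendant per vertex of degree at least 2, so sending
  a core pendant to its neighbour is injective; the vertices of degree at least 2 themselves give
  the other half.\<close>

lemma card_core_le: "card {v. core v} \<le> 2 * card (V_ge2 {..<n} E)"
proof -
  let ?B = "{v. \<exists>h. pendant v h \<and> (\<forall>v'. pendant v' h \<longrightarrow> key v' \<le> key v)}"
  have "?B \<subseteq> {..<n}" using pendant_lt by blast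
  then have fin: "finite ?B" using finite_subset by blast
  define nb where "nb v = (SOME h. pendant v h)" for v
  have nb: "nb v = h" if "pendant v h" for v h
    unfolding nb_def using that pendant_unique by (metis someI)
  have "inj_on nb ?B"
  proof (rule inj_onI)
    fix x y assume *: "x \<in> ?B" "y \<in> ?B" "nb x = nb y"
    then obtain h h' where h: "pendant x h" "\<forall>v'. pendant v' h \<longrightarrow> key v' \<le> key x"
       "pendant y h'" "\<forall>v'. pendant v' h' \<longrightarrow> key v' \<le> key y" by auto
    then have "h = h'" using nb *(3) by metis
    then have "key x = key y" using h by (meson antisym)
    then show "x = y" using inj_on_key h pendant_lt by (auto dest: inj_onD)
  qed
  moreover have "nb ` ?B \<subseteq> V_ge2 {..<n} E"
    using nb pendant_lt by (auto simp: V_ge2_def pendant_def)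
  moreover have fV: "finite (V_ge2 {..<n} E)" by (auto simp: V_ge2_def)
  ultimately have "card ?B \<le> card (V_ge2 {..<n} E)" by (rule card_inj_on_le)
  moreover have "{v. core v} \<subseteq> V_ge2 {..<n} E \<union> ?B" by (auto simp: core_def V_ge2_def)
  then have "card {v. core v} \<le> card (V_ge2 {..<n} E \<union> ?B)" using fin fV by (intro card_mono) auto
  ultimately show ?thesis using card_Un_le[of "V_ge2 {..<n} E" ?B] by linarith
qed

section \<open>Candidate selections and matchings\<close>

definition outer :: "nat set \<Rightarrow> nat set" where
  "outer S = {v. \<not> core v \<and> (\<exists>h. pendant v h \<and> h \<notin> S)}"

definition iso_min :: "nat set" where
  "iso_min = {v. \<exists>u. iso_edge v u \<and> v < u}"

text \<open>The threshold \<open>t = n\<close> yields the empty set.\<close>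

definition above :: "nat \<Rightarrow> nat set" where
  "above t = {v. t < n \<and> key t \<le> key v}"

text \<open>A pendant of a vertex in \<open>S\<close> would cover no new edge and is therefore not
  offered by \<open>outer\<close>; an isolated edge is represented by its smaller end, since
  choosing both ends gains nothing.\<close>

definition sel :: "nat set \<Rightarrow> nat \<Rightarrow> nat \<Rightarrow> nat set" where
  "sel S t s = S \<union> (outer S \<inter> above t) \<union> (iso_min \<inter> above s)"

text \<open>An isolated edge meets no other edge, so every covered one joins the matching. Inside
  the core \<open>Q\<close> decides, read only for \<open>u < v\<close>, which leaves its diagonal
  free to code \<open>S\<close>. Disjointness is not built in and has to be tested.\<close>

definition mat :: "nat set \<Rightarrow> (nat \<Rightarrow> nat \<Rightarrow> bool) \<Rightarrow> nat \<Rightarrow> nat \<Rightarrow> nat set set" where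
  "mat S Q t s = {e \<in> edges_at E (sel S t s).
     (\<exists>u v. e = {u, v} \<and> u < v \<and> core u \<and> core v \<and> Q u v) \<or> (\<exists>u v. e = {u, v} \<and> iso_edge u v)}"

lemma core_lt: "core v \<Longrightarrow> v < n" by (simp add: core_def)

lemma not_core_deg: "{u, v} \<in> E \<Longrightarrow> \<not> core u \<Longrightarrow> deg u = 1"
  using deg_cases edge_ends by (auto simp: core_def)

lemma iso_edge_not_core: "iso_edge u v \<Longrightarrow> \<not> core u"
  using nbr_unique[of u v] unfolding iso_edge_def core_def pendant_def
  by (metis numeral_le_one_iff semiring_norm(69))

lemma iso_edge_sym: "iso_edge u v \<longleftrightarrow> iso_edge v u"
  by (auto simp: iso_edge_def insert_commute)

text \<open>Turns a choice inside one class of vertices into a threshold of the same size and no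
  smaller weight; it is applied to pendants and to isolated edges separately.\<close>

lemma exists_above:
  assumes "X \<subseteq> {..<n}" "A \<subseteq> X"
  obtains t where "t \<le> n" "card (X \<inter> above t) = card A" "sum wdeg A \<le> sum wdeg (X \<inter> above t)"
proof -
  have fX: "finite X" using assms(1) finite_subset by blast
  obtain U where U: "U \<subseteq> X" "U = {} \<or> (\<exists>t\<in>X. U = {v \<in> X. key t \<le> key v})" "card U = card A"
     "sum wdeg A \<le> sum wdeg U"
  proof -
    have "\<exists>U\<subseteq>X. (U = {} \<or> (\<exists>t\<in>X. U = {v \<in> X. key t \<le> key v})) \<and> card U = card A \<and>
      (\<forall>B\<subseteq>X. card B = card A \<longrightarrow> sum wdeg B \<le> sum wdeg U)"
    proof (rule exists_upset_dominating[OF fX inj_on_subset[OF inj_on_key assms(1)]])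
      show "wdeg x \<le> wdeg y" if "x \<in> X" "y \<in> X" "key x \<le> key y" for x y
        using that assms(1) by (intro key_mono) auto
      show "card A \<le> card X" by (rule card_mono[OF fX assms(2)])
    qed
    then show thesis using that assms(2) by blast
  qed
  have "\<exists>t\<le>n. U = X \<inter> above t"
  proof (cases "U = {}")
    case True then show ?thesis by (intro exI[of _ n]) (auto simp: above_def)
  next
    case False
    then obtain t where "t \<in> X" "U = {v \<in> X. key t \<le> key v}" using U(2) by auto
    then show ?thesis using assms(1) by (intro exI[of _ t]) (auto simp: above_def)
  qed
  then show ?thesis using that U(3,4) by auto
qed

section \<open>The exchange argument\<close>

definition solution :: "nat set \<Rightarrow> nat set set \<Rightarrow> nat \<Rightarrow> nat \<Rightarrow> nat \<Rightarrow> bool" where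
  "solution V0 M k1 k2 k3 \<longleftrightarrow> V0 \<subseteq> {..<n} \<and> card V0 \<le> k1 \<and> k2 \<le> (\<Sum>e\<in>edges_at E V0. w e) \<and>
     M \<subseteq> edges_at E V0 \<and> disjoint M \<and> k3 \<le> (\<Sum>e\<in>M. w e)"

text \<open>In a matching without such edges, each edge lies inside the core or is isolated.\<close>

definition bad :: "nat set \<Rightarrow> bool" where
  "bad e \<longleftrightarrow> (\<exists>p h. e = {p, h} \<and> pendant p h \<and> \<not> core p)"

text \<open>
  A pendant edge \<open>{p, h}\<close> of the matching is replaced by the heaviest pendant edge \<open>{b, h}\<close>; if it
  was covered through \<open>p\<close> only, \<open>p\<close> is replaced by \<open>b\<close>.
\<close>

lemma exchange:
  assumes sol: "solution V0 M k1 k2 k3" and e: "e \<in> M" "bad e"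
  shows "\<exists>V1 M1. solution V1 M1 k1 k2 k3 \<and> card {e \<in> M1. bad e} < card {e \<in> M. bad e}"
proof -
  obtain p h where p: "e = {p, h}" "pendant p h" "\<not> core p" using e by (auto simp: bad_def)
  obtain b where b: "pendant b h" "core b" "key p \<le> key b" using obtain_core_pendant[OF p(2)] .
  have pb: "p \<noteq> b" using p b by auto
  have lt: "p < n" "h < n" "b < n" using p b pendant_lt by auto
  have hd: "2 \<le> deg h" and pd: "deg p = 1" and bd: "deg b = 1" and pE: "{p, h} \<in> E" and bE: "{b, h} \<in> E"
    using p b by (auto simp: pendant_def)
  have ph: "p \<noteq> h" "b \<noteq> h" using hd pd bd by auto
  have wle: "w {p, h} \<le> w {b, h}"
    using key_mono[OF b(3)] lt wdeg_deg_1[OF pd pE] wdeg_deg_1[OF bd bE] by simp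
  have V0: "V0 \<subseteq> {..<n}" "card V0 \<le> k1" "k2 \<le> sum w (edges_at E V0)"
    and M: "M \<subseteq> edges_at E V0" "disjoint M" "k3 \<le> sum w M"
    using sol by (auto simp: solution_def)
  have ME: "M \<subseteq> E" using M(1) by (auto simp: edges_at_def)
  have fM: "finite M" using ME finite_E finite_subset by blast
  have fV0: "finite V0" using V0(1) finite_subset by blast
  have eh: "e' = e" if "e' \<in> M" "h \<in> e'" for e'
  proof (rule ccontr)
    assume "e' \<noteq> e"
    then have "e' \<inter> e = {}" using M(2) that(1) e(1) unfolding disjoint_def by blast
    then show False using that(2) p(1) by blast
  qed
  \<comment> \<open>The only edge at \<open>b\<close> is \<open>{b, h}\<close>, and \<open>h\<close>
    is already matched by \<open>e\<close>; so \<open>b\<close> is free.\<close>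
  have bM: "b \<notin> e'" if "e' \<in> M" for e'
  proof
    assume be: "b \<in> e'"
    then have "e' = {b, h}" using deg_1_edge_unique[OF bd _ bE] that ME by auto
    then have "e' = e" using eh that by auto
    then show False using \<open>e' = {b, h}\<close> p(1) pb ph by (auto simp: doubleton_eq_iff)
  qed
  define M1 where "M1 = insert {b, h} (M - {e})"
  have bhM: "{b, h} \<notin> M" using bM by auto
  have d1: "disjoint M1"
    unfolding disjoint_def
  proof (intro ballI impI)
    fix x y assume xy: "x \<in> M1" "y \<in> M1" "x \<noteq> y"
    have "{b, h} \<inter> z = {}" if "z \<in> M - {e}" for z
      using that bM eh by auto
    then show "x \<inter> y = {}"
      using xy M(2) unfolding M1_def disjoint_def by (metis Diff_iff inf_commute insert_iff)
  qed
  have "sum w M1 = w {b, h} + sum w (M - {e})" unfolding M1_def using fM bhM by simp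
  moreover have "sum w M = w e + sum w (M - {e})" using fM e(1) by (simp add: sum.remove)
  ultimately have s1: "k3 \<le> sum w M1" using M(3) wle p(1) by simp
  have "\<not> bad {b, h}"
  proof
    assume "bad {b, h}"
    then obtain p' h' where "{b, h} = {p', h'}" "pendant p' h'" "\<not> core p'" by (auto simp: bad_def)
    then show False using b(2) hd by (auto simp: doubleton_eq_iff pendant_def)
  qed
  then have "{e \<in> M1. bad e} = {e \<in> M. bad e} - {e}" unfolding M1_def by auto
  then have less: "card {e \<in> M1. bad e} < card {e \<in> M. bad e}"
    using e fM card_Diff1_less[of "{e \<in> M. bad e}" e] by simp
  show ?thesis
  \<comment> \<open>If \<open>h\<close> or \<open>b\<close> is selected, the new edge is covered and
    the selection can stay as it is.\<close>
  proof (cases "h \<in> V0 \<or> b \<in> V0")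
    case True
    then have "{b, h} \<in> edges_at E V0" using bE by (auto simp: edges_at_def)
    then have "solution V0 M1 k1 k2 k3" unfolding solution_def
      using V0 M(1) d1 s1 by (auto simp: M1_def)
    then show ?thesis using less by blast
  next
    case False
    then have pV: "p \<in> V0" using M(1) e(1) p(1) by (auto simp: edges_at_def)
    define V1 where "V1 = insert b (V0 - {p})"
    have c1: "card V1 \<le> k1" using V0(2) pV fV0 False card_Suc_Diff1[OF fV0 pV] by (simp add: V1_def)
    \<comment> \<open>Both \<open>p\<close> and \<open>b\<close> have degree 1 and \<open>h\<close>
      is not selected, so swapping them trades \<open>e\<close> for \<open>{b, h}\<close> and
      changes no other covered edge.\<close>
    have at: "edges_at E V1 = insert {b, h} (edges_at E V0 - {e})"
    proof (intro equalityI subsetI)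
      fix x assume x: "x \<in> edges_at E V1"
      then have xE: "x \<in> E" by (auto simp: edges_at_def)
      from x consider "b \<in> x" | y where "y \<in> x" "y \<in> V0" "y \<noteq> p" by (auto simp: edges_at_def V1_def)
      then show "x \<in> insert {b, h} (edges_at E V0 - {e})"
      proof cases
        case 1
        then show ?thesis using deg_1_edge_unique[OF bd xE bE] by auto
      next
        case 2
        have "y \<noteq> h" using 2 False by auto
        then have "x \<noteq> e" using 2 p(1) by auto
        then show ?thesis using 2 xE by (auto simp: edges_at_def)
      qed
    next
      fix x assume x: "x \<in> insert {b, h} (edges_at E V0 - {e})"
      show "x \<in> edges_at E V1"
      proof (cases "x = {b, h}")
        case True then show ?thesis using bE by (auto simp: edges_at_def V1_def)
      next
        case False
        then have x': "x \<in> E" "x \<noteq> e" "x \<inter> V0 \<noteq> {}" using x by (auto simp: edges_at_def)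
        then have "p \<notin> x" using deg_1_edge_unique[OF pd x'(1) pE] p(1) by auto
        then show ?thesis using x' by (auto simp: edges_at_def V1_def)
      qed
    qed
    have fat: "finite (edges_at E V0)" using finite_E by (auto simp: edges_at_def)
    have "{b, h} \<notin> edges_at E V0" using False by (auto simp: edges_at_def)
    then have "sum w (edges_at E V1) = w {b, h} + sum w (edges_at E V0 - {e})"
      unfolding at using fat by simp
    moreover have "sum w (edges_at E V0) = w e + sum w (edges_at E V0 - {e})"
      using fat M(1) e(1) by (intro sum.remove) auto
    ultimately have "k2 \<le> sum w (edges_at E V1)" using V0(3) wle p(1) by simp
    moreover have "M1 \<subseteq> edges_at E V1" unfolding at M1_def using M(1) by auto
    moreover have "V1 \<subseteq> {..<n}" using V0(1) lt by (auto simp: V1_def)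
    ultimately have "solution V1 M1 k1 k2 k3" unfolding solution_def using c1 d1 s1 by auto
    then show ?thesis using less by blast
  qed
qed

text \<open>Each exchange lowers the number of bad edges.\<close>

lemma solution_without_bad:
  assumes "solution V0 M k1 k2 k3"
  shows "\<exists>V1 M1. solution V1 M1 k1 k2 k3 \<and> (\<forall>e\<in>M1. \<not> bad e)"
  using assms
proof (induction "card {e \<in> M. bad e}" arbitrary: V0 M rule: less_induct)
  case less
  show ?case
  proof (cases "\<forall>e\<in>M. \<not> bad e")
    case False
    then obtain e where "e \<in> M" "bad e" by blast
    then obtain V1 M1 where "solution V1 M1 k1 k2 k3" "card {e \<in> M1. bad e} < card {e \<in> M. bad e}"
      using exchange[OF less.prems] by blast
    then show ?thesis using less.hyps by blast
  qed (use less.prems in blast)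
qed

lemma mepvcb_yes_solution: "mepvcb_yes {..<n} E w k1 k2 k3 \<longleftrightarrow> (\<exists>V0 M. solution V0 M k1 k2 k3)"
  unfolding mepvcb_yes_def solution_def by blast

section \<open>Coverage and the normal form\<close>

lemma edges_at_Un: "edges_at E (A \<union> B) = edges_at E A \<union> edges_at E B"
  by (auto simp: edges_at_def)

text \<open>Each vertex of \<open>A\<close> has a single edge, and two of them could share it only
  by being adjacent; so vertices of \<open>A\<close> and covered edges correspond.\<close>

lemma sum_edges_at_deg_1:
  assumes "finite A" "\<And>v. v \<in> A \<Longrightarrow> deg v = 1" "\<And>u v. u \<in> A \<Longrightarrow> v \<in> A \<Longrightarrow> {u, v} \<notin> E"
  shows "sum w (edges_at E A) = sum wdeg A"
proof -
  have "\<exists>u. {v, u} \<in> E" if "v \<in> A" for v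
  proof -
    have "0 < card {u. u < n \<and> {v, u} \<in> E}" using assms(2)[OF that] by (simp add: deg_card)
    then show ?thesis by (auto simp: card_gt_0_iff)
  qed
  then obtain nb where nb: "\<And>v. v \<in> A \<Longrightarrow> {v, nb v} \<in> E" by metis
  have "edges_at E A = (\<lambda>v. {v, nb v}) ` A"
    using nb deg_1_edge_unique[OF assms(2)] by (fastforce simp: edges_at_def)
  moreover have "inj_on (\<lambda>v. {v, nb v}) A"
  proof (rule inj_onI)
    fix x y assume *: "x \<in> A" "y \<in> A" "{x, nb x} = {y, nb y}"
    show "x = y"
    proof (rule ccontr)
      assume "x \<noteq> y"
      then have "nb x = y" using *(3) by (auto simp: doubleton_eq_iff)
      then show False using assms(3)[OF *(1,2)] nb[OF *(1)] by simp
    qed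
  qed
  moreover have "wdeg v = w {v, nb v}" if "v \<in> A" for v
    using wdeg_deg_1 assms(2) nb that by blast
  ultimately show ?thesis by (simp add: sum.reindex)
qed

lemma outer_D: "v \<in> outer S \<Longrightarrow> \<not> core v \<and> deg v = 1 \<and> v < n \<and> (\<forall>u. {v, u} \<in> E \<longrightarrow> 2 \<le> deg u \<and> u \<notin> S)"
proof -
  assume "v \<in> outer S"
  then obtain h where h: "\<not> core v" "pendant v h" "h \<notin> S" by (auto simp: outer_def)
  have "u = h" if "{v, u} \<in> E" for u
    using nbr_unique[of v h u] h(2) that by (simp add: pendant_def)
  then show ?thesis using h pendant_lt by (auto simp: pendant_def)
qed

lemma iso_min_D: "v \<in> iso_min \<Longrightarrow> \<not> core v \<and> deg v = 1 \<and> v < n \<and>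
   (\<forall>u. {v, u} \<in> E \<longrightarrow> deg u = 1 \<and> \<not> core u \<and> v < u)"
proof -
  assume "v \<in> iso_min"
  then obtain h where h: "iso_edge v h" "v < h" by (auto simp: iso_min_def)
  have "u = h" if "{v, u} \<in> E" for u
    using nbr_unique[of v h u] h that by (simp add: iso_edge_def)
  then show ?thesis
    using h iso_edge_not_core[of v h] iso_edge_not_core[of h v] iso_edge_sym edge_ends[of v h]
    by (auto simp: iso_edge_def)
qed

text \<open>No edge is counted twice: an edge at \<open>A\<close> leads to a vertex of degree at
  least 2 outside \<open>S\<close>, and an edge at \<open>B\<close> has both ends of degree 1 and
  outside the core.\<close>

lemma sum_edges_at_parts:
  assumes "S \<subseteq> {v. core v}" "A \<subseteq> outer S" "B \<subseteq> iso_min"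
  shows "sum w (edges_at E (S \<union> A \<union> B)) = sum w (edges_at E S) + sum wdeg A + sum wdeg B"
proof -
  note oD = outer_D[OF subsetD[OF assms(2)]] and iD = iso_min_D[OF subsetD[OF assms(3)]]
  have fA: "finite A" using oD by (intro finite_subset[of A "{..<n}"]) auto
  have fB: "finite B" using iD by (intro finite_subset[of B "{..<n}"]) auto
  have fin: "finite (edges_at E X)" for X using finite_E by (auto simp: edges_at_def)
  have sA: "sum w (edges_at E A) = sum wdeg A"
  proof (rule sum_edges_at_deg_1[OF fA])
    fix u v assume "u \<in> A" "v \<in> A"
    then show "{u, v} \<notin> E" using oD[of u] oD[of v] by auto
  qed (use oD in auto)
  have sB: "sum w (edges_at E B) = sum wdeg B"
  proof (rule sum_edges_at_deg_1[OF fB])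
    fix u v assume "u \<in> B" "v \<in> B"
    then show "{u, v} \<notin> E" using iD[of u] iD[of v] by (metis insert_commute less_asym)
  qed (use iD in auto)
  have dSA: "edges_at E S \<inter> edges_at E A = {}"
  proof (rule ccontr)
    assume "edges_at E S \<inter> edges_at E A \<noteq> {}"
    then obtain e x y where e: "e \<in> E" "x \<in> e" "x \<in> S" "y \<in> e" "y \<in> A" by (auto simp: edges_at_def)
    then have "x \<noteq> y" using oD assms(1) by auto
    then have "e = {y, x}" using edge_eq e by blast
    then show False using oD[OF e(5)] e by auto
  qed
  have dSB: "edges_at E S \<inter> edges_at E B = {}"
  proof (rule ccontr)
    assume "edges_at E S \<inter> edges_at E B \<noteq> {}"
    then obtain e x y where e: "e \<in> E" "x \<in> e" "x \<in> S" "y \<in> e" "y \<in> B" by (auto simp: edges_at_def)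
    then have "x \<noteq> y" using iD assms(1) by auto
    then have "e = {y, x}" using edge_eq e by blast
    then show False using iD[OF e(5)] e assms(1) by auto
  qed
  have dAB: "edges_at E A \<inter> edges_at E B = {}"
  proof (rule ccontr)
    assume "edges_at E A \<inter> edges_at E B \<noteq> {}"
    then obtain e x y where e: "e \<in> E" "x \<in> e" "x \<in> A" "y \<in> e" "y \<in> B" by (auto simp: edges_at_def)
    obtain z where z: "e = {x, z}" using edge_at e by blast
    then have "2 \<le> deg z" "deg x = 1" using oD[OF e(3)] e(1) by auto
    then have "y = x" using iD[OF e(5)] e z by auto
    then show False using iD[OF e(5)] oD[OF e(3)] e(1) z by auto
  qed
  show ?thesis unfolding edges_at_Un using dSA dSB dAB fin sA sB
    by (subst sum.union_disjoint; auto)+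
qed

text \<open>From a solution without bad edges keep the core part \<open>S\<close> of the selection
  and let \<open>Q\<close> be membership in the matching. The selected pendants \<open>A\<close> and
  the touched isolated edges \<open>B\<close> are then exchanged for upper sets of the same sizes,
  which neither enlarges the selection nor lowers either total.\<close>

theorem normal_form:
  "mepvcb_yes {..<n} E w k1 k2 k3 \<longleftrightarrow>
    (\<exists>S\<subseteq>{v. core v}. \<exists>Q. \<exists>t\<le>n. \<exists>s\<le>n. card (sel S t s) \<le> k1 \<and> k2 \<le> sum w (edges_at E (sel S t s)) \<and>
       disjoint (mat S Q t s) \<and> k3 \<le> sum w (mat S Q t s))" (is "?L \<longleftrightarrow> ?R")
proof
  assume ?R
  then obtain S Q t s where *: "S \<subseteq> {v. core v}" "card (sel S t s) \<le> k1" "k2 \<le> sum w (edges_at E (sel S t s))"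
      "disjoint (mat S Q t s)" "k3 \<le> sum w (mat S Q t s)" by blast
  have "outer S \<subseteq> {..<n}" "iso_min \<subseteq> {..<n}" "S \<subseteq> {..<n}"
    using outer_D iso_min_D core_lt *(1) by (fast, fast, fast)
  then have "sel S t s \<subseteq> {..<n}" by (auto simp: sel_def)
  moreover have "mat S Q t s \<subseteq> edges_at E (sel S t s)" by (auto simp: mat_def)
  ultimately have "solution (sel S t s) (mat S Q t s) k1 k2 k3" using * by (simp add: solution_def)
  then show ?L using mepvcb_yes_solution by blast
next
  assume ?L
  then obtain V0 M where sol: "solution V0 M k1 k2 k3" and good: "\<forall>e\<in>M. \<not> bad e"
    using mepvcb_yes_solution solution_without_bad by metis
  have V0: "V0 \<subseteq> {..<n}" "card V0 \<le> k1" "k2 \<le> sum w (edges_at E V0)"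
    and M: "M \<subseteq> edges_at E V0" "disjoint M" "k3 \<le> sum w M"
    using sol by (auto simp: solution_def)
  have ME: "M \<subseteq> E" using M(1) by (auto simp: edges_at_def)
  have fM: "finite M" using ME finite_E finite_subset by blast
  have fV0: "finite V0" using V0(1) finite_subset by blast
  have fin: "finite (edges_at E X)" for X using finite_E by (auto simp: edges_at_def)
  define S where "S = V0 \<inter> {v. core v}"
  define Q where "Q u v \<longleftrightarrow> {u, v} \<in> M" for u v
  define A where "A = V0 \<inter> outer S"
  \<comment> \<open>The representative is taken even if only the other end of its edge was
    selected.\<close>
  define B where "B = {v \<in> iso_min. \<exists>u. {v, u} \<in> E \<and> (v \<in> V0 \<or> u \<in> V0)}"
  obtain t where t: "t \<le> n" "card (outer S \<inter> above t) = card A" "sum wdeg A \<le> sum wdeg (outer S \<inter> above t)"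
    using exists_above[of "outer S" A] outer_D by (force simp: A_def)
  obtain s where s: "s \<le> n" "card (iso_min \<inter> above s) = card B" "sum wdeg B \<le> sum wdeg (iso_min \<inter> above s)"
    using exists_above[of iso_min B] iso_min_D by (force simp: B_def)
  have S: "S \<subseteq> {v. core v}" by (auto simp: S_def)

  \<comment> \<open>Each touched isolated edge owns a selected end, chosen by \<open>f\<close>;
    these ends are distinct and lie neither in the core nor in \<open>outer S\<close>, so they pay
    for \<open>B\<close>.\<close>
  have cB: "card B \<le> card (V0 - S - A)"
  proof -
    have "\<forall>v\<in>B. \<exists>x. x \<in> V0 \<and> (x = v \<or> {v, x} \<in> E)" by (auto simp: B_def)
    then obtain f where f: "\<And>v. v \<in> B \<Longrightarrow> f v \<in> V0 \<and> (f v = v \<or> {v, f v} \<in> E)" by metis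
    have fd: "deg (f v) = 1" "\<not> core (f v)" "v \<le> f v" if "v \<in> B" for v
      using f[OF that] iso_min_D[of v] that by (auto simp: B_def)
    have fo: "f v \<notin> outer S" if vB: "v \<in> B" for v
    proof
      assume o: "f v \<in> outer S"
      have v: "v \<in> iso_min" using vB by (auto simp: B_def)
      obtain u where u: "{v, u} \<in> E" using vB by (auto simp: B_def)
      show False
      proof (cases "f v = v")
        case True
        then show False using outer_D[OF o] iso_min_D[OF v] u by force
      next
        case False
        then have "{f v, v} \<in> E" using f[OF vB] by (auto simp: insert_commute)
        then show False using outer_D[OF o] iso_min_D[OF v] by force
      qed
    qed
    have "inj_on f B"
    proof (rule inj_onI)
      fix x y assume *: "x \<in> B" "y \<in> B" "f x = f y"
      then have i: "x \<in> iso_min" "y \<in> iso_min" by (auto simp: B_def)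
      show "x = y"
      proof (rule ccontr)
        assume ne: "x \<noteq> y"
        consider "f x = x" | "f y = y" | "{x, f x} \<in> E" "{y, f y} \<in> E" using f *(1,2) by blast
        then show False
        proof cases
          case 1
          then have "{y, x} \<in> E" using f[OF *(2)] *(3) ne by auto
          then show False using iso_min_D[OF i(1)] iso_min_D[OF i(2)] by (metis insert_commute less_asym)
        next
          case 2
          then have "{x, y} \<in> E" using f[OF *(1)] *(3) ne by auto
          then show False using iso_min_D[OF i(1)] iso_min_D[OF i(2)] by (metis insert_commute less_asym)
        next
          case 3
          then have "{x, f x} = {y, f x}" using deg_1_edge_unique[of "f x"] fd(1)[OF *(1)] *(3) by auto
          then show False using ne 3 edge_ends[of x "f x"] by (auto simp: doubleton_eq_iff)
        qed
      qed
    qed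
    moreover have "f ` B \<subseteq> V0 - S - A" using f fd fo by (auto simp: S_def A_def)
    ultimately show ?thesis using fV0 by (metis card_inj_on_le finite_Diff)
  qed
  have SA: "S \<inter> A = {}" using outer_D by (auto simp: S_def A_def)
  have "card (sel S t s) \<le> card S + card A + card B"
    unfolding sel_def t(2)[symmetric] s(2)[symmetric]
    by (meson add_le_cancel_right card_Un_le order_trans)
  also have "\<dots> \<le> card S + card A + card (V0 - S - A)" using cB by simp
  also have "\<dots> = card (S \<union> A) + card (V0 - (S \<union> A))"
    using SA fV0 by (simp add: card_Un_disjoint S_def A_def Diff_Un Diff_eq Int_assoc)
  also have "\<dots> = card V0"
    using fV0 card_mono[OF fV0, of "S \<union> A"] card_Diff_subset[of "S \<union> A" V0]
    by (auto simp: S_def A_def)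
  finally have 1: "card (sel S t s) \<le> k1" using V0(2) by simp

  \<comment> \<open>The vertices lost from \<open>V0\<close> are pendants of vertices in
    \<open>S\<close>, ends of isolated edges whose representative is in \<open>B\<close>, and
    vertices without edges; no covered edge is lost with them.\<close>
  have sub: "edges_at E V0 \<subseteq> edges_at E (S \<union> A \<union> B)"
  proof
    fix e assume e: "e \<in> edges_at E V0"
    then obtain x where x: "x \<in> e" "x \<in> V0" "e \<in> E" by (auto simp: edges_at_def)
    then obtain y where y: "e = {x, y}" using edge_at by blast
    show "e \<in> edges_at E (S \<union> A \<union> B)"
    proof (cases "x \<in> S \<or> y \<in> S")
      case True then show ?thesis using x(3) y by (auto simp: edges_at_def)
    next
      case False
      then have nc: "\<not> core x" "deg x = 1" using x y not_core_deg by (auto simp: S_def)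
      consider "2 \<le> deg y" | "deg y = 1" using deg_cases[of y x] x(3) y by (auto simp: insert_commute)
      then show ?thesis
      proof cases
        case 1
        then have "x \<in> A" using nc False x y by (auto simp: A_def outer_def pendant_def)
        then show ?thesis using x(3) y by (auto simp: edges_at_def)
      next
        case 2
        then have "iso_edge x y" "iso_edge y x" using nc x y by (auto simp: iso_edge_def insert_commute)
        moreover have "x < y \<or> y < x" using edge_ends[of x y] x y by auto
        ultimately have "x \<in> B \<or> y \<in> B" using x y by (auto simp: B_def iso_min_def insert_commute)
        then show ?thesis using x(3) y by (auto simp: edges_at_def)
      qed
    qed
  qed
  have "k2 \<le> sum w (edges_at E (S \<union> A \<union> B))" using V0(3) sum_mono2[OF fin sub, of w] by simp
  also have "\<dots> = sum w (edges_at E S) + sum wdeg A + sum wdeg B"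
    by (rule sum_edges_at_parts) (auto simp: S_def A_def B_def)
  also have "\<dots> \<le> sum w (edges_at E S) + sum wdeg (outer S \<inter> above t) + sum wdeg (iso_min \<inter> above s)"
    using t(3) s(3) by simp
  also have "\<dots> = sum w (edges_at E (sel S t s))"
    unfolding sel_def by (rule sum_edges_at_parts[symmetric]) (auto simp: S_def)
  finally have 2: "k2 \<le> sum w (edges_at E (sel S t s))" .

  define MC where "MC = {e \<in> M. \<forall>x\<in>e. core x}"
  have mat_eq: "mat S Q t s = MC \<union> edges_at E (iso_min \<inter> above s)"
  proof (intro equalityI subsetI)
    fix e assume "e \<in> mat S Q t s"
    then consider u v where "e = {u, v}" "core u" "core v" "{u, v} \<in> M"
      | u v where "e = {u, v}" "iso_edge u v" "e \<in> edges_at E (sel S t s)"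
      by (auto simp: mat_def Q_def)
    then show "e \<in> MC \<union> edges_at E (iso_min \<inter> above s)"
    proof cases
      case 1 then show ?thesis by (auto simp: MC_def)
    next
      case 2
      have eE: "e \<in> E" and d: "deg u = 1" "deg v = 1" using 2 by (auto simp: iso_edge_def)
      have "\<not> core u" "\<not> core v" using iso_edge_not_core 2 iso_edge_sym by auto
      moreover have "u \<notin> outer S" using outer_D[of u S] eE 2 d by fastforce
      moreover have "v \<notin> outer S" using outer_D[of v S] eE 2 d by (fastforce simp: insert_commute)
      ultimately have "e \<inter> (iso_min \<inter> above s) \<noteq> {}" using 2 S by (auto simp: edges_at_def sel_def)
      then show ?thesis using eE by (auto simp: edges_at_def)
    qed
  next
    fix e assume "e \<in> MC \<union> edges_at E (iso_min \<inter> above s)"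
    then consider "e \<in> MC" | x where "e \<in> E" "x \<in> e" "x \<in> iso_min" "x \<in> above s"
      by (auto simp: edges_at_def)
    then show "e \<in> mat S Q t s"
    proof cases
      case 1
      then have e: "e \<in> M" "\<forall>x\<in>e. core x" by (auto simp: MC_def)
      then obtain u v where uv: "e = {u, v}" "u < v" using edge_cases ME by blast
      \<comment> \<open>The covering vertex of a matching edge inside the core is itself in the
        core, hence in \<open>S\<close> and still selected.\<close>
      moreover have "e \<inter> V0 \<noteq> {}" using e(1) M(1) by (auto simp: edges_at_def)
      then have "e \<inter> S \<noteq> {}" using e(2) by (auto simp: S_def)
      then have "e \<in> edges_at E (sel S t s)" using e(1) ME by (auto simp: edges_at_def sel_def)
      ultimately show ?thesis using e unfolding mat_def Q_def by blast
    next
      case 2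
      obtain y where y: "e = {x, y}" using edge_at[OF 2(1,2)] by blast
      then have "iso_edge x y" using iso_min_D[OF 2(3)] 2 by (auto simp: iso_edge_def)
      moreover have "e \<in> edges_at E (sel S t s)" using 2 by (auto simp: edges_at_def sel_def)
      ultimately show ?thesis using y unfolding mat_def by blast
    qed
  qed
  have iso_all: "deg x = 1 \<and> \<not> core x" if ea: "e \<in> edges_at E X" "X \<subseteq> iso_min" "x \<in> e" for e X x
  proof -
    obtain y where y: "e \<in> E" "y \<in> e" "y \<in> iso_min" using ea(1,2) by (auto simp: edges_at_def)
    then obtain z where "e = {y, z}" using edge_at by blast
    then show ?thesis using iso_min_D[OF y(3)] y ea(3) by auto
  qed
  have 3: "disjoint (mat S Q t s)"
    unfolding disjoint_def
  proof (intro ballI impI)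
    fix e e' assume e: "e \<in> mat S Q t s" "e' \<in> mat S Q t s" "e \<noteq> e'"
    show "e \<inter> e' = {}"
    proof (cases "e \<in> MC \<and> e' \<in> MC")
      case True
      then have "e \<in> M" "e' \<in> M" by (auto simp: MC_def)
      then show ?thesis using M(2) e(3) unfolding disjoint_def by blast
    next
      case False
      have eE: "e \<in> E" "e' \<in> E" using e(1,2) by (auto simp: mat_def edges_at_def)
      show ?thesis
      proof (rule ccontr)
        assume "e \<inter> e' \<noteq> {}"
        then obtain x where x: "x \<in> e" "x \<in> e'" by auto
        \<comment> \<open>Two distinct edges meeting here would share a vertex of degree 1, since
          one of them is isolated.\<close>
        have "e \<in> edges_at E (iso_min \<inter> above s) \<or> e' \<in> edges_at E (iso_min \<inter> above s)"
          using False e(1,2) unfolding mat_eq by blast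
        then have "deg x = 1" using x iso_all[of _ "iso_min \<inter> above s" x] by blast
        then show False using deg_1_edge_unique eE x e(3) by blast
      qed
    qed
  qed
  \<comment> \<open>With no bad edge in \<open>M\<close>, a matching edge that leaves the core is
    isolated; being touched by \<open>V0\<close>, it has its smaller end in
    \<open>B\<close>.\<close>
  have "M \<subseteq> MC \<union> edges_at E B"
  proof
    fix e assume e: "e \<in> M"
    then obtain u v where uv: "e = {u, v}" "u < v" using edge_cases ME by blast
    have uvE: "{u, v} \<in> E" "{v, u} \<in> E" using e ME uv by (auto simp: insert_commute)
    have tch: "u \<in> V0 \<or> v \<in> V0" using e M(1) uv by (auto simp: edges_at_def)
    show "e \<in> MC \<union> edges_at E B"
    proof (cases "core u \<and> core v")
      case True then show ?thesis using e uv by (auto simp: MC_def)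
    next
      case False
      have "deg u = 1 \<and> deg v = 1"
      proof (rule ccontr)
        assume n1: "\<not> (deg u = 1 \<and> deg v = 1)"
        have "\<not> bad {u, v}" "\<not> bad {v, u}" using good e uv by (auto simp: insert_commute)
        then have "\<not> (pendant u v \<and> \<not> core u)" "\<not> (pendant v u \<and> \<not> core v)" by (auto simp: bad_def)
        moreover have "2 \<le> deg u \<longrightarrow> core u" "2 \<le> deg v \<longrightarrow> core v"
          using edge_ends[OF uvE(1)] by (simp_all add: core_def)
        moreover have "pendant u v \<or> pendant v u \<or> (2 \<le> deg u \<and> 2 \<le> deg v)"
          using n1 uvE deg_cases[OF uvE(1)] deg_cases[OF uvE(2)] by (simp add: pendant_def) linarith
        ultimately show False using False unfolding pendant_def by blast
      qed
      then have "u \<in> B" using uv uvE tch by (auto simp: B_def iso_min_def iso_edge_def)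
      then show ?thesis using uv uvE by (auto simp: edges_at_def)
    qed
  qed
  then have "sum w M \<le> sum w (MC \<union> edges_at E B)"
    using fM fin by (intro sum_mono2) (auto simp: MC_def)
  also have "\<dots> \<le> sum w MC + sum w (edges_at E B)"
    using fM fin by (simp add: sum_Un_nat MC_def)
  also have "sum w (edges_at E B) = sum wdeg B"
    using sum_edges_at_parts[of "{}" "{}" B] by (auto simp: B_def edges_at_def)
  also have "\<dots> \<le> sum wdeg (iso_min \<inter> above s)" by (rule s(3))
  also have "\<dots> = sum w (edges_at E (iso_min \<inter> above s))"
    using sum_edges_at_parts[of "{}" "{}" "iso_min \<inter> above s"] by (auto simp: edges_at_def)
  also have "sum w MC + \<dots> = sum w (mat S Q t s)"
    unfolding mat_eq
  proof (rule sum.union_disjoint[symmetric])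
    show "MC \<inter> edges_at E (iso_min \<inter> above s) = {}"
    proof (rule ccontr)
      assume "MC \<inter> edges_at E (iso_min \<inter> above s) \<noteq> {}"
      then obtain e where e: "e \<in> MC" "e \<in> edges_at E (iso_min \<inter> above s)" by auto
      then obtain x where "x \<in> e" by (auto simp: edges_at_def)
      then show False using e iso_all[of e _ x] by (auto simp: MC_def)
    qed
  qed (use fM fin in \<open>auto simp: MC_def\<close>)
  finally have 4: "k3 \<le> sum w (mat S Q t s)" using M(3) by simp
  show ?R using S t(1) s(1) 1 2 3 4 by blast
qed

text \<open>A proper colouring of the vertices of degree at least 2 extends to all: a pendant takes
  the colour opposite to its neighbour, and an isolated edge is coloured by the order of its
  ends.\<close>

lemma bipartite_iff:
  "bipartite {..<n} E \<longleftrightarrow>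
    (\<exists>Q :: nat \<Rightarrow> bool. \<forall>u v. {u, v} \<in> E \<and> 2 \<le> deg u \<and> 2 \<le> deg v \<longrightarrow> Q u \<noteq> Q v)" (is "?L \<longleftrightarrow> ?R")
proof
  assume ?L
  then obtain X Y where XY: "X \<union> Y = {..<n}" "X \<inter> Y = {}" "\<forall>e\<in>E. \<exists>x\<in>X. \<exists>y\<in>Y. e = {x, y}"
    unfolding bipartite_def by blast
  have "(u \<in> X) \<noteq> (v \<in> X)" if "{u, v} \<in> E" for u v
    using XY(2,3) that by (metis disjoint_iff doubleton_eq_iff)
  then show ?R by (intro exI[of _ "\<lambda>u. u \<in> X"]) simp
next
  assume ?R
  then obtain Q :: "nat \<Rightarrow> bool" where Q: "\<And>u v. {u, v} \<in> E \<Longrightarrow> 2 \<le> deg u \<Longrightarrow> 2 \<le> deg v \<Longrightarrow> Q u \<noteq> Q v" by blast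
  define col where "col v \<longleftrightarrow> (if 2 \<le> deg v then Q v else \<exists>u. {v, u} \<in> E \<and>
     (if 2 \<le> deg u then \<not> Q u else v < u))" for v
  have low: "col v = (if 2 \<le> deg u then \<not> Q u else v < u)" if "{v, u} \<in> E" "\<not> 2 \<le> deg v" for u v
  proof -
    have "deg v = 1" using that deg_cases by blast
    then have "u' = u" if "{v, u'} \<in> E" for u'
      using nbr_unique \<open>{v, u} \<in> E\<close> that by blast
    then have "(\<exists>u'. {v, u'} \<in> E \<and> (if 2 \<le> deg u' then \<not> Q u' else v < u')) \<longleftrightarrow>
        (if 2 \<le> deg u then \<not> Q u else v < u)"
      using that(1) by metis
    then show ?thesis using that(2) by (simp add: col_def)
  qed
  have hi: "col v = Q v" if "2 \<le> deg v" for v using that by (simp add: col_def)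
  have diff: "col u \<noteq> col v" if "{u, v} \<in> E" for u v
  proof -
    have vu: "{v, u} \<in> E" using that by (simp add: insert_commute)
    show ?thesis
      using low[OF that] low[OF vu] hi[of u] hi[of v] Q[OF that] edge_ends[OF that]
      by (cases "2 \<le> deg u"; cases "2 \<le> deg v") auto
  qed
  have "\<exists>x\<in>{v. v < n \<and> col v}. \<exists>y\<in>{v. v < n \<and> \<not> col v}. e = {x, y}" if e: "e \<in> E" for e
  proof -
    obtain u v where uv: "e = {u, v}" using edge_cases e by blast
    then show ?thesis using diff[of u v] edge_ends[of u v] e
      by (cases "col u") (auto simp: insert_commute)
  qed
  then show ?L unfolding bipartite_def
    by (intro exI[of _ "{v. v < n \<and> col v}"] exI[of _ "{v. v < n \<and> \<not> col v}"]) auto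
qed

end

section \<open>The algorithm as an expression\<close>

text \<open>Environments end in an arbitrary tail, so variables are looked up by peeling off
  entries; the unfolding into list indexing is removed from the simpset below.\<close>

lemma eval_Var_Cons [simp]:
  "eval xs (x # \<rho>) (Var 0) = x"
  "eval xs (x # \<rho>) (Var (Suc i)) = eval xs \<rho> (Var i)"
  "eval xs (x # \<rho>) (Var 1) = eval xs \<rho> (Var 0)"
  "eval xs (x # \<rho>) (Var (numeral m)) = eval xs \<rho> (Var (pred_numeral m))"
  by (auto simp: numeral_eq_Suc)

declare eval.simps(1) [simp del]

text \<open>\<open>app f js\<close> passes arguments by copying the variables \<open>js\<close> to
  the front of the environment. Each copy moves the older variables one place back, hence the offset
  \<open>k\<close>; the last copy ends up at position 0, hence the reversal in
  \<open>app\<close>.\<close>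

primrec bind_vars :: "nat \<Rightarrow> nat list \<Rightarrow> exp \<Rightarrow> exp" where
  "bind_vars k [] f = f"
| "bind_vars k (j # js) f = Bind (Var (k + j)) (bind_vars (Suc k) js f)"

definition app :: "exp \<Rightarrow> nat list \<Rightarrow> exp" where
  "app f js = bind_vars 0 (rev js) f"

lemma eval_bind_vars:
  "eval xs (\<sigma> @ \<rho>) (bind_vars (length \<sigma>) js f) =
     eval xs (rev (map (\<lambda>j. eval xs \<rho> (Var j)) js) @ \<sigma> @ \<rho>) f"
proof (induction js arbitrary: \<sigma>)
  case (Cons j js)
  have "eval xs (\<sigma> @ \<rho>) (Var (length \<sigma> + j)) = eval xs \<rho> (Var j)"
    by (simp add: eval.simps(1) nth_append)
  then show ?case using Cons[of "eval xs \<rho> (Var j) # \<sigma>"] by simp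
qed simp

lemma eval_app [simp]: "eval xs \<rho> (app f js) = eval xs (map (\<lambda>j. eval xs \<rho> (Var j)) js @ \<rho>) f"
  using eval_bind_vars[of xs "[]" \<rho> "rev js" f] by (simp add: app_def rev_map)

lemma clipped_bind_vars: "clipped (bind_vars k js f) = clipped f"
  by (induction js arbitrary: k) auto

lemma clipped_app [simp]: "clipped (app f js) = clipped f"
  by (simp add: app_def clipped_bind_vars)

section \<open>Logic, graph notions and the search as expressions\<close>

definition "Neg a = Ifz a (Num 1) (Num 0)"
definition "And a b = Ifz a (Num 0) b"
definition "Or a b = Ifz a b (Num 1)"
definition "Leq a b = Neg (Minus a b)"
definition "Bool a = Ifz a (Num 0) (Num 1)"
definition "When a b = Ifz a (Num 0) b"

definition "nE = Inp (Num 0)"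
definition "SumV b = Sum (Clip nE) b"
definition "AllV b = Neg (SumV (Neg b))"
definition "CntV b = SumV (Bool b)"

lemmas logic_defs = Neg_def And_def Or_def Leq_def Bool_def When_def nE_def SumV_def AllV_def CntV_def

lemma eval_logic [simp]:
  "0 < eval xs \<rho> (Neg a) \<longleftrightarrow> \<not> 0 < eval xs \<rho> a"
  "0 < eval xs \<rho> (And a b) \<longleftrightarrow> 0 < eval xs \<rho> a \<and> 0 < eval xs \<rho> b"
  "0 < eval xs \<rho> (Or a b) \<longleftrightarrow> 0 < eval xs \<rho> a \<or> 0 < eval xs \<rho> b"
  "0 < eval xs \<rho> (Leq a b) \<longleftrightarrow> eval xs \<rho> a \<le> eval xs \<rho> b"
  "eval xs \<rho> (Bool a) = (if 0 < eval xs \<rho> a then 1 else 0)"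
  "eval xs \<rho> (When a b) = (if 0 < eval xs \<rho> a then eval xs \<rho> b else 0)"
  by (auto simp: logic_defs)

lemma clipped_logic [simp]:
  "clipped (Neg a) = clipped a"
  "clipped (And a b) = (clipped a \<and> clipped b)"
  "clipped (Or a b) = (clipped a \<and> clipped b)"
  "clipped (Leq a b) = (clipped a \<and> clipped b)"
  "clipped (Bool a) = clipped a"
  "clipped (When a b) = (clipped a \<and> clipped b)"
  "clipped nE"
  "clipped (SumV b) = clipped b"
  "clipped (AllV b) = clipped b"
  "clipped (CntV b) = clipped b"
  by (auto simp: logic_defs)

text \<open>
  The expressions below expect their arguments at the front of the environment, in the order shown
  by the lemmas \<open>eval_rawE\<close>, \<open>eval_edgeE\<close> and so on. Truth values are numbers, nonzero meaning true.
\<close>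

definition "rawE = Inp (Plus (Num 4) (Plus (Sum (Clip (Var 0)) nE) (Var 1)))"

text \<open>The language has no product, so \<open>n * n\<close> is a repeated sum. Comparing
  entries in one direction, but over all ordered pairs, gives symmetry.\<close>

definition "validE =
  And (And (Leq Len (Plus (Num 4) (Sum (Clip nE) nE))) (Leq (Plus (Num 4) (Sum (Clip nE) nE)) Len))
   (AllV (And (Neg (app rawE [0, 0]))
     (AllV (Leq (app rawE [0, 1]) (app rawE [1, 0])))))"

text \<open>The range tests make the value agree with \<open>wt\<close> for all arguments, not only
  for vertices.\<close>

definition "edgeE = When (Minus nE (Var 0)) (When (Minus nE (Var 1)) rawE)"
definition "degE = CntV (app edgeE [1, 0])"
definition "wdegE = SumV (app edgeE [1, 0])"
definition "keyE = Plus (SumV (app wdegE [1])) (Var 0)"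
definition "hiE = Minus degE (Num 1)"
definition "loE = And degE (Neg hiE)"
definition "pendE = And edgeE (And (app loE [0]) (app hiE [1]))"
definition "isoE = And edgeE (And (app loE [0]) (app loE [1]))"
definition "coreE = Or hiE (SumV (And (app pendE [1, 0])
   (AllV (Or (Neg (app pendE [0, 1])) (Leq (app keyE [0]) (app keyE [2]))))))"
definition "rankE = CntV (And (Minus (Var 1) (Var 0)) (app coreE [0]))"
definition "sizeE = CntV (app coreE [0])"
text \<open>A shift by repeated halving, followed by the parity
  \<open>y - (y div 2 + y div 2)\<close>.\<close>

definition "bitE = Bind (Iter (Clip (Var 1)) (Var 0) (Halve (Var 0)))
   (Minus (Var 0) (Plus (Halve (Var 0)) (Halve (Var 0))))"
definition "guessE = Bind (Plus (Sum (Clip (app rankE [1])) sizeE) (app rankE [2])) (app bitE [1, 0])"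
definition "memE = And coreE (app guessE [1, 0, 0])"
definition "aboveE = And (Minus nE (Var 0)) (Leq (app keyE [0]) (app keyE [1]))"
definition "selE = Or (app memE [0, 3]) (Or
   (And (Neg (app coreE [0])) (And (app aboveE [2, 0])
     (SumV (And (app pendE [1, 0]) (Neg (app memE [0, 4]))))))
   (And (app aboveE [1, 0]) (SumV (And (app isoE [1, 0]) (Minus (Var 0) (Var 1))))))"
definition "touchE = Or (app selE [0, 2, 3, 4]) (app selE [1, 2, 3, 4])"
definition "matE = And edgeE (And touchE
   (Or (And (app coreE [0]) (And (app coreE [1]) (app guessE [4, 0, 1]))) isoE))"
definition "cardE = CntV (app selE [0, 1, 2, 3])"
definition "coverE = SumV (SumV (When (And (Minus (Var 0) (Var 1)) (app touchE [1, 0, 2, 3, 4]))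
   (app edgeE [1, 0])))"
definition "matchE = SumV (SumV (When (And (Minus (Var 0) (Var 1)) (app matE [1, 0, 2, 3, 4]))
   (app edgeE [1, 0])))"
text \<open>\<open>matE\<close> is correct only for arguments in increasing order, hence the two
  cases.\<close>

definition "disjE = AllV (Leq (CntV (Or (And (Minus (Var 1) (Var 0)) (app matE [0, 1, 2, 3, 4]))
   (And (Minus (Var 0) (Var 1)) (app matE [1, 0, 2, 3, 4])))) (Num 1))"
definition "checkE = And (Leq cardE (Inp (Num 1))) (And (Leq (Inp (Num 2)) coverE)
   (And (Leq (Inp (Num 3)) matchE) disjE))"
definition "searchE = Sum (Clip (Plus nE (Num 1))) (Sum (Clip (Plus nE (Num 1))) checkE)"
definition "bipE = AllV (AllV (Or (Neg (And (app edgeE [1, 0]) (And (app hiE [1]) (app hiE [0]))))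
   (Or (And (app guessE [2, 1, 1]) (Neg (app guessE [2, 0, 0])))
       (And (app guessE [2, 0, 0]) (Neg (app guessE [2, 1, 1]))))))"
definition "paramE = CntV (app hiE [0])"
text \<open>Repeated doubling. Its loops cannot be clipped, as \<open>4k^2\<close> may exceed the
  input length; their cost depends on \<open>k\<close> alone.\<close>

definition "powE = Iter (Sum (Var 0) (Sum (Num 4) (Var 2))) (Num 1) (Plus (Var 0) (Var 0))"
definition "posE = And (Inp (Num 1)) (And (Inp (Num 2)) (Inp (Num 3)))"
text \<open>Colourings and solutions are searched in two separate loops over the same range, so the
  costs add up instead of multiplying.\<close>

definition "mainE = Ifz validE (Num 0) (Bind paramE (Bind powE
   (Bool (And posE (And (Sum (Var 0) bipE) (Sum (Var 0) searchE))))))"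

lemmas exp_defs = rawE_def validE_def edgeE_def degE_def wdegE_def keyE_def hiE_def loE_def pendE_def
  isoE_def coreE_def rankE_def sizeE_def bitE_def guessE_def memE_def aboveE_def selE_def touchE_def
  matE_def cardE_def coverE_def matchE_def disjE_def checkE_def searchE_def bipE_def paramE_def posE_def

lemma clipped_exps:
  "clipped validE" "clipped searchE" "clipped bipE" "clipped paramE" "clipped posE"
  by (simp_all add: exp_defs)

lemma eval_powE: "eval xs (k # \<rho>) powE = 2 ^ (4 * k\<^sup>2)"
proof -
  have "((\<lambda>y. y + y) ^^ m) (1 :: nat) = 2 ^ m" for m by (induction m) auto
  then show ?thesis by (simp add: powE_def power2_eq_square algebra_simps)
qed

text \<open>The cost is quadratic in \<open>k\<close>, which \<open>x + 1 \<le> 2 ^ x\<close> at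
  \<open>x = 4k^2\<close> absorbs; 60 is a generous round constant.\<close>

lemma cost_powE: "cost xs (k # \<rho>) powE \<le> 60 * 2 ^ (4 * k\<^sup>2)"
proof -
  have "cost xs (k # \<rho>) powE = 44 * k\<^sup>2 + 36 * k + 6"
    by (simp add: powE_def power2_eq_square algebra_simps)
  also have "\<dots> \<le> 60 * (4 * k\<^sup>2 + 1)" by (cases k) (auto simp: power2_eq_square)
  also have "\<dots> \<le> 60 * 2 ^ (4 * k\<^sup>2)"
    using Suc_leI[OF less_exp[of "4 * k\<^sup>2"]] by (intro mult_le_mono2) simp
  finally show ?thesis .
qed

section \<open>Recognising encodings of weighted graphs\<close>

lemma nth_concat_map_upt:
  assumes "i < m" "j < n"
  shows "concat (map (\<lambda>i. map (f i) [0..<n]) [0..<m]) ! (i * n + j) = f i j"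
  using assms
proof (induction m)
  case (Suc m)
  have len: "length (concat (map (\<lambda>i. map (f i) [0..<n]) [0..<m])) = m * n"
    by (simp add: length_concat comp_def sum_list_triv)
  show ?case
  proof (cases "i = m")
    case True
    then show ?thesis using Suc.prems len by (simp add: nth_append)
  next
    case False
    then have "i < m" using Suc.prems by simp
    then have "Suc i * n \<le> m * n" by (intro mult_le_mono1) simp
    then have "i * n + j < m * n" using Suc.prems(2) by simp
    then show ?thesis using Suc.IH[OF \<open>i < m\<close>] Suc.prems len by (simp add: nth_append)
  qed
qed simp

lemma length_encode: "length (encode n E w k1 k2 k3) = 4 + n * n"
  by (simp add: encode_def length_concat comp_def sum_list_triv)

lemma encode_nth:
  "encode n E w k1 k2 k3 ! 0 = n" "encode n E w k1 k2 k3 ! Suc 0 = k1"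
  "encode n E w k1 k2 k3 ! 2 = k2" "encode n E w k1 k2 k3 ! 3 = k3"
  by (simp_all add: encode_def)

lemma encode_nth_edge:
  assumes "i < n" "j < n"
  shows "encode n E w k1 k2 k3 ! (4 + (i * n + j)) = (if {i, j} \<in> E then w {i, j} else 0)"
  using nth_concat_map_upt[OF assms, of "\<lambda>i j. if {i, j} \<in> E then w {i, j} else 0"]
  by (simp add: encode_def)

lemma mat_index_bound: "i < n \<Longrightarrow> j < (n :: nat) \<Longrightarrow> i * n + j < n * n"
proof -
  assume *: "i < n" "j < n"
  then have "Suc i * n \<le> n * n" by (intro mult_le_mono1) simp
  with * show ?thesis by simp
qed

lemma mat_index_cases:
  assumes "p < n * (n :: nat)"
  obtains i j where "i < n" "j < n" "p = i * n + j"
proof (rule that[of "p div n" "p mod n"])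
  have "0 < n" using assms by (cases n) auto
  then show "p mod n < n" by simp
  show "p div n < n" using assms by (simp add: less_mult_imp_div_less)
qed simp

lemma min_add_square: "m \<le> n \<Longrightarrow> min m (4 + n * n) = (m :: nat)"
  using le_square[of n] by (intro min_absorb1) linarith

lemma eval_rawE:
  assumes "length xs = 4 + n * n" "xs ! 0 = n" "u < n" "v < n"
  shows "eval xs (u # v # \<rho>) rawE = xs ! (4 + (u * n + v))"
  using assms mat_index_bound[OF assms(3,4)] min_add_square[of u n] by (simp add: rawE_def nE_def)

lemma eval_SumV:
  assumes "length xs = 4 + n * n" "xs ! 0 = n"
  shows "eval xs \<rho> (SumV b) = (\<Sum>i<n. eval xs (i # \<rho>) b)"
  using assms min_add_square[of n n] by (simp add: SumV_def nE_def)

lemma eval_AllV: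
  assumes "length xs = 4 + n * n" "xs ! 0 = n"
  shows "0 < eval xs \<rho> (AllV b) \<longleftrightarrow> (\<forall>i<n. 0 < eval xs (i # \<rho>) b)"
proof -
  have "\<not> 0 < eval xs \<rho> (SumV (Neg b)) \<longleftrightarrow> (\<forall>i<n. \<not> 0 < eval xs (i # \<rho>) (Neg b))"
    unfolding eval_SumV[OF assms] by (simp del: eval_logic) blast
  then show ?thesis unfolding AllV_def by simp
qed

text \<open>The clipped sum in \<open>validE\<close> computes the left-hand product with
  \<open>min\<close>. Clipping cannot have taken effect: a length \<open>l\<close> below
  \<open>m\<close> would satisfy \<open>l = 4 + l * m\<close>, which exceeds
  \<open>l\<close>.\<close>

lemma length_condition:
  assumes "length xs = 4 + min m (length xs) * (m :: nat)"
  shows "length xs = 4 + m * m"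
proof (cases "m \<le> length xs")
  case True
  then show ?thesis using assms by (simp add: min_absorb1)
next
  case False
  then have 1: "min m (length xs) = length xs" by (intro min_absorb2) simp
  have "length xs = 4 + length xs * m" using assms unfolding 1 .
  moreover have "length xs * 1 \<le> length xs * m" using False by (intro mult_le_mono2) simp
  ultimately show ?thesis by linarith
qed

lemma eval_validE:
  "0 < eval xs \<rho> validE \<longleftrightarrow>
     (\<exists>n E w k1 k2 k3. weighted_graph {..<n} E w \<and> xs = encode n E w k1 k2 k3)" (is "?L \<longleftrightarrow> ?R")
proof
  assume ?R
  then obtain n E w k1 k2 k3 where g: "weighted_graph {..<n} E w" and xs: "xs = encode n E w k1 k2 k3" by blast
  have len: "length xs = 4 + n * n" and n: "xs ! 0 = n" by (simp_all add: xs length_encode encode_nth)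
  have raw: "eval xs (u # v # \<rho>) rawE = (if {u, v} \<in> E then w {u, v} else 0)" if "u < n" "v < n" for u v \<rho>
    unfolding eval_rawE[OF len n that] using encode_nth_edge[OF that] by (simp add: xs)
  have "{u} \<notin> E" for u using g
    by (force simp: weighted_graph_def simple_graph_def)
  then show ?L using len n min_add_square[of n n]
    by (simp add: validE_def eval_AllV[OF len n] raw insert_commute) (simp add: nE_def)
next
  assume L: ?L
  define n where "n = xs ! 0"
  \<comment> \<open>\<open>validE\<close> demands at least four entries, so \<open>xs ! 0\<close> is
    a genuine one and is what \<open>nE\<close> reads.\<close>
  have "length xs \<noteq> 0" using L by (auto simp: validE_def nE_def)
  then have "eval xs \<rho> nE = n" for \<rho> by (simp add: nE_def n_def)
  then have "length xs = 4 + min n (length xs) * n"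
    using L by (simp add: validE_def)
  then have len: "length xs = 4 + n * n" by (rule length_condition)
  note n = n_def[symmetric]
  define a where "a u v = xs ! (4 + (u * n + v))" for u v
  have raw: "eval xs (u # v # \<rho>) rawE = a u v" if "u < n" "v < n" for u v \<rho>
    unfolding eval_rawE[OF len n that] a_def ..
  have a0: "a u u = 0" and a_le: "a v u \<le> a u v" if "u < n" "v < n" for u v
    using L that by (auto simp: validE_def eval_AllV[OF len n] raw)
  have a_sym: "a u v = a v u" if "u < n" "v < n" for u v
    using a_le that by (meson antisym)
  define E where "E = {{u, v} | u v. u < n \<and> v < n \<and> 0 < a u v}"
  \<comment> \<open>Weights live on sets; by symmetry of the matrix, the entry with the smaller end
    as its row recovers them.\<close>
  define w where "w e = a (Min e) (Max e)" for e
  have w: "w {u, v} = a u v" if "u < n" "v < n" for u v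
    using a_sym[OF that] by (simp add: w_def min_def max_def)
  have E: "{u, v} \<in> E \<longleftrightarrow> 0 < a u v" if "u < n" "v < n" for u v
    using a_sym that by (auto simp: E_def doubleton_eq_iff)
  have "weighted_graph {..<n} E w"
    unfolding weighted_graph_def simple_graph_def
  proof (intro conjI ballI)
    fix e assume "e \<in> E"
    then obtain u v where *: "e = {u, v}" "u < n" "v < n" "0 < a u v" by (auto simp: E_def)
    then show "0 < w e" using w by simp
    have "u \<noteq> v" using * a0 by auto
    with * show "\<exists>u\<in>{..<n}. \<exists>v\<in>{..<n}. u \<noteq> v \<and> e = {u, v}" by blast
  qed simp
  moreover have "xs = encode n E w (xs ! 1) (xs ! 2) (xs ! 3)" (is "xs = ?ys")
  proof (rule nth_equalityI)
    show "length xs = length ?ys" by (simp add: len length_encode)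
    fix i assume i: "i < length xs"
    show "xs ! i = ?ys ! i"
    proof (cases "i < 4")
      case True
      then have "i = 0 \<or> i = 1 \<or> i = 2 \<or> i = 3" by linarith
      then show ?thesis by (auto simp: encode_nth n_def)
    next
      case False
      define p where "p = i - 4"
      have ip: "i = 4 + p" using False by (simp add: p_def)
      then have "p < n * n" using i len by simp
      then obtain u v where uv: "u < n" "v < n" "p = u * n + v" by (rule mat_index_cases)
      show ?thesis unfolding ip uv(3) encode_nth_edge[OF uv(1,2)] using E[OF uv(1,2)] w[OF uv(1,2)]
        by (simp add: a_def)
    qed
  qed
  ultimately show ?R by blast
qed

section \<open>Correctness and running time\<close>

lemma exists_bits: "\<exists>g<2 ^ N. \<forall>p<N. odd (g div 2 ^ p :: nat) \<longleftrightarrow> P p"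
proof (induction N arbitrary: P)
  case (Suc N)
  obtain g :: nat where g: "g < 2 ^ N" "\<forall>p<N. odd (g div 2 ^ p) \<longleftrightarrow> P (Suc p)"
    using Suc.IH[of "\<lambda>p. P (Suc p)"] by blast
  define h where "h = 2 * g + of_bool (P 0)"
  have "odd (h div 2 ^ p) \<longleftrightarrow> P p" if "p < Suc N" for p
  proof (cases p)
    case 0 then show ?thesis by (simp add: h_def)
  next
    case (Suc q)
    have "h div 2 ^ p = (h div 2) div 2 ^ q" by (simp add: Suc div_mult2_eq)
    also have "h div 2 = g" by (simp add: h_def)
    finally show ?thesis using g(2) that Suc by simp
  qed
  moreover have "h < 2 ^ Suc N" using g(1) by (simp add: h_def)
  ultimately show ?case by blast
qed simp

lemma funpow_halve: "((\<lambda>y. y div 2) ^^ m) g = g div (2 ^ m :: nat)"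
  by (induction m) (simp_all add: div_mult2_eq power_Suc2 del: power_Suc)

text \<open>Through this, sums act as bounded existential quantifiers over guesses, thresholds and
  vertices.\<close>

lemma sum_pos_iff: "0 < (\<Sum>i<m. f i) \<longleftrightarrow> (\<exists>i<m. 0 < (f i :: nat))" for m :: nat
  by (induction m) (auto simp: less_Suc_eq)

section \<open>Numbers as guesses about the core\<close>

context wgraph
begin

lemma sum_edges:
  assumes "X \<subseteq> E"
  shows "sum w X = (\<Sum>u<n. \<Sum>v<n. if u < v \<and> {u, v} \<in> X then wt u v else 0)"
proof -
  let ?D = "{p \<in> {..<n} \<times> {..<n}. fst p < snd p \<and> {fst p, snd p} \<in> X}"
  have "X = (\<lambda>p. {fst p, snd p}) ` ?D"
  proof (intro equalityI subsetI)
    fix e assume e: "e \<in> X"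
    then obtain u v where uv: "e = {u, v}" "u < v" using edge_cases assms by blast
    then have "(u, v) \<in> ?D" using e edge_ends[of u v] assms by auto
    then show "e \<in> (\<lambda>p. {fst p, snd p}) ` ?D" using uv by (intro image_eqI[of _ _ "(u, v)"]) simp_all
  qed auto
  moreover have "inj_on (\<lambda>p. {fst p, snd p}) ?D"
    by (rule inj_onI) (auto simp: doubleton_eq_iff prod_eq_iff)
  ultimately have "sum w X = (\<Sum>p\<in>?D. w {fst p, snd p})"
    by (metis (no_types, lifting) sum.reindex_cong)
  also have "\<dots> = (\<Sum>p\<in>?D. wt (fst p) (snd p))"
    using assms by (intro sum.cong) (auto simp: wt_def)
  also have "\<dots> = (\<Sum>p\<in>{..<n} \<times> {..<n}. if fst p < snd p \<and> {fst p, snd p} \<in> X then wt (fst p) (snd p) else 0)"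
    by (rule sum.inter_filter) simp
  also have "\<dots> = (\<Sum>u<n. \<Sum>v<n. if u < v \<and> {u, v} \<in> X then wt u v else 0)"
    by (simp add: sum.cartesian_product case_prod_beta)
  finally show ?thesis .
qed

text \<open>Two distinct edges meet exactly when some vertex has two partners; this reduces
  disjointness to one count per vertex.\<close>

lemma disjoint_edges_iff:
  assumes "X \<subseteq> E"
  shows "disjoint X \<longleftrightarrow> (\<forall>v<n. card {u. u < n \<and> {u, v} \<in> X} \<le> 1)"
proof
  assume d: "disjoint X"
  show "\<forall>v<n. card {u. u < n \<and> {u, v} \<in> X} \<le> 1"
  proof (intro allI impI)
    fix v assume "v < n"
    have "x = y" if "{x, v} \<in> X" "{y, v} \<in> X" for x y
    proof -
      have "{x, v} = {y, v}" using disjointD[OF d that] by auto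
      then show ?thesis by (auto simp: doubleton_eq_iff)
    qed
    then show "card {u. u < n \<and> {u, v} \<in> X} \<le> 1"
      by (simp add: card_le_Suc0_iff_eq)
  qed
next
  assume c: "\<forall>v<n. card {u. u < n \<and> {u, v} \<in> X} \<le> 1"
  show "disjoint X"
    unfolding disjoint_def
  proof (intro ballI impI, rule ccontr)
    fix e e' assume e: "e \<in> X" "e' \<in> X" "e \<noteq> e'" "e \<inter> e' \<noteq> {}"
    then obtain x where x: "x \<in> e" "x \<in> e'" by blast
    obtain y z where yz: "e = {x, y}" "e' = {x, z}"
      using edge_at[of e x] edge_at[of e' x] e x assms by (metis subsetD)
    then have ends: "x < n" "y < n" "z < n" using edge_ends e assms by blast+
    have "{y, x} \<in> X" "{z, x} \<in> X" using e yz by (simp_all add: insert_commute)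
    then have "y = z" using c ends by (auto simp: card_le_Suc0_iff_eq)
    then show False using yz e(3) by simp
  qed
qed

text \<open>Consecutive numbering of the core: with vertex numbers as indices, a guess would need
  about \<open>n * n\<close> bits, too many for a bound in the parameter.\<close>

definition rank :: "nat \<Rightarrow> nat" where
  "rank v = card {u. u < v \<and> core u}"

text \<open>
  A number codes a square bit matrix indexed by the core: the diagonal is the selected part of the
  core, the upper triangle the part of the matching inside it.
\<close>

definition guess :: "nat \<Rightarrow> nat \<Rightarrow> nat \<Rightarrow> bool" where
  "guess g u v \<longleftrightarrow> odd (g div 2 ^ (rank u * card {v. core v} + rank v))"

lemma finite_core: "finite {v. core v}"
  using core_lt by (intro finite_subset[of "{v. core v}" "{..<n}"]) auto

lemma rank_less: "core v \<Longrightarrow> rank v < card {v. core v}"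
  unfolding rank_def using finite_core by (intro psubset_card_mono) auto

lemma rank_strict_mono: "core u \<Longrightarrow> u < v \<Longrightarrow> rank u < rank v"
  unfolding rank_def by (intro psubset_card_mono) (auto intro: less_trans)

lemma rank_inj: "core u \<Longrightarrow> core v \<Longrightarrow> rank u = rank v \<Longrightarrow> u = v"
  using rank_strict_mono by (metis less_irrefl linorder_neqE_nat)

lemma card_core_le_n: "card {v. core v} \<le> n"
  using card_mono[of "{..<n}" "{v. core v}"] core_lt by auto

text \<open>Bit positions are two-digit numbers in base \<open>?c\<close> whose digits are ranks, so
  distinct pairs of core vertices get distinct bits. \<open>card_core_le\<close>, used for both
  digits, yields the exponent.\<close>

lemma exists_guess:
  "\<exists>g < 2 ^ (4 * (card (V_ge2 {..<n} E))\<^sup>2). \<forall>u v. core u \<longrightarrow> core v \<longrightarrow> guess g u v = R u v"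
proof -
  let ?c = "card {v. core v}"
  define P where "P p \<longleftrightarrow> (\<exists>u v. core u \<and> core v \<and> p = rank u * ?c + rank v \<and> R u v)" for p
  obtain g :: nat where g: "g < 2 ^ (?c * ?c)" "\<forall>p < ?c * ?c. odd (g div 2 ^ p) \<longleftrightarrow> P p"
    using exists_bits[of "?c * ?c" P] by blast
  have "guess g u v = R u v" if uv: "core u" "core v" for u v
  proof -
    have less: "rank u * ?c + rank v < ?c * ?c" using uv rank_less mat_index_bound by blast
    have "P (rank u * ?c + rank v) \<longleftrightarrow> R u v"
    proof
      assume "P (rank u * ?c + rank v)"
      then obtain u' v' where *: "core u'" "core v'" "rank u * ?c + rank v = rank u' * ?c + rank v'" "R u' v'"
        unfolding P_def by blast
      have "(rank u * ?c + rank v) div ?c = rank u" "(rank u * ?c + rank v) mod ?c = rank v"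
        "(rank u' * ?c + rank v') div ?c = rank u'" "(rank u' * ?c + rank v') mod ?c = rank v'"
        using rank_less[OF uv(2)] rank_less[OF *(2)] by simp_all
      then have "rank u = rank u'" "rank v = rank v'" using *(3) by metis+
      then show "R u v" using rank_inj uv *(1,2,4) by metis
    qed (use uv in \<open>auto simp: P_def\<close>)
    then show ?thesis using g(2) less unfolding guess_def by blast
  qed
  moreover have "?c * ?c \<le> 4 * (card (V_ge2 {..<n} E))\<^sup>2"
    using mult_le_mono[OF card_core_le card_core_le] by (simp add: power2_eq_square)
  then have "g < 2 ^ (4 * (card (V_ge2 {..<n} E))\<^sup>2)"
    using g(1) by (meson less_le_trans one_le_numeral power_increasing)
  ultimately show ?thesis by blast
qed

end

section \<open>Values of the expressions on encoded instances\<close>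

locale mepvcb_instance = wgraph +
  fixes k1 k2 k3 :: nat and xs :: "nat list"
  assumes xs: "xs = encode n E w k1 k2 k3"
begin

lemma len: "length xs = 4 + n * n" and nth_0: "xs ! 0 = n"
  by (simp_all add: xs length_encode encode_nth)

lemma eval_nE [simp]: "eval xs \<rho> nE = n" by (simp add: nE_def len nth_0)

lemma eval_ks [simp]:
  "eval xs \<rho> (Inp (Num (Suc 0))) = k1" "eval xs \<rho> (Inp (Num 2)) = k2" "eval xs \<rho> (Inp (Num 3)) = k3"
  by (simp_all add: xs length_encode encode_nth)

lemmas eval_sum [simp] = eval_SumV[OF len nth_0] eval_AllV[OF len nth_0]

lemma eval_CntV [simp]: "eval xs \<rho> (CntV b) = card {i. i < n \<and> 0 < eval xs (i # \<rho>) b}"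
proof -
  have "eval xs \<rho> (CntV b) = (\<Sum>i<n. if 0 < eval xs (i # \<rho>) b then 1 else 0)"
    by (simp add: CntV_def)
  also have "\<dots> = card {i \<in> {..<n}. 0 < eval xs (i # \<rho>) b}"
    by (simp add: sum.inter_filter[symmetric])
  finally show ?thesis by simp
qed

lemma eval_edgeE [simp]: "eval xs (u # v # \<rho>) edgeE = wt u v"
proof (cases "u < n \<and> v < n")
  case True
  then show ?thesis
    using eval_rawE[OF len nth_0, of u v \<rho>] encode_nth_edge[of u n v E w k1 k2 k3]
    by (simp add: edgeE_def wt_def xs[symmetric])
next
  case False
  then show ?thesis using edge_ends[of u v] by (auto simp: edgeE_def wt_def)
qed

lemma eval_degE [simp]: "eval xs (v # \<rho>) degE = deg v"
  by (simp add: degE_def wt_pos_iff deg_card)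

lemma eval_wdegE [simp]: "eval xs (v # \<rho>) wdegE = wdeg v"
  by (simp add: wdegE_def wdeg_def)

lemma eval_keyE [simp]: "eval xs (v # \<rho>) keyE = key v"
  by (simp add: keyE_def key_def)

lemma eval_hiE [simp]: "0 < eval xs (v # \<rho>) hiE \<longleftrightarrow> 2 \<le> deg v"
  by (auto simp: hiE_def)

lemma eval_loE [simp]: "0 < eval xs (v # \<rho>) loE \<longleftrightarrow> deg v = 1"
  by (auto simp: loE_def)

lemma eval_pendE [simp]: "0 < eval xs (v # h # \<rho>) pendE \<longleftrightarrow> pendant v h"
  by (auto simp: pendE_def wt_pos_iff pendant_def)

lemma eval_isoE [simp]: "0 < eval xs (u # v # \<rho>) isoE \<longleftrightarrow> iso_edge u v"
  by (auto simp: isoE_def wt_pos_iff iso_edge_def)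

text \<open>The form that \<open>coreE\<close> evaluates: all quantifiers are bounded by
  \<open>n\<close>, and \<open>v < n\<close> follows from having an edge.\<close>

lemma core_iff: "core v \<longleftrightarrow> 2 \<le> deg v \<or>
   (\<exists>h<n. pendant v h \<and> (\<forall>v'<n. \<not> pendant v' h \<or> key v' \<le> key v))"
proof -
  have "v < n" if "2 \<le> deg v"
  proof -
    have "{u. u < n \<and> {v, u} \<in> E} \<noteq> {}"
      using that unfolding deg_card by (metis card.empty not_numeral_le_zero)
    then show ?thesis using edge_ends by blast
  qed
  then show ?thesis unfolding core_def using pendant_lt by meson
qed

lemma eval_coreE [simp]: "0 < eval xs (v # \<rho>) coreE \<longleftrightarrow> core v"
  unfolding core_iff coreE_def by (simp add: sum_pos_iff)

lemma eval_rankE [simp]: "eval xs (v # \<rho>) rankE = rank v"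
proof -
  have "{i. i < n \<and> i < v \<and> core i} = {u. u < v \<and> core u}" using core_lt by blast
  then show ?thesis by (simp add: rankE_def rank_def)
qed

lemma eval_sizeE [simp]: "eval xs \<rho> sizeE = card {v. core v}"
proof -
  have "{i. i < n \<and> core i} = {v. core v}" using core_lt by blast
  then show ?thesis by (simp add: sizeE_def)
qed

lemma eval_bitE: "p \<le> length xs \<Longrightarrow> 0 < eval xs (g # p # \<rho>) bitE \<longleftrightarrow> odd (g div 2 ^ p)"
proof -
  assume p: "p \<le> length xs"
  have "eval xs (g # p # \<rho>) bitE = g div 2 ^ p - (g div 2 ^ p div 2 + g div 2 ^ p div 2)"
    using p by (simp add: bitE_def funpow_halve min_absorb1)
  also have "x - (x div 2 + x div 2) = x mod 2" for x :: nat by presburger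
  finally show ?thesis by (simp add: odd_iff_mod_2_eq_one)
qed

text \<open>For core vertices the bit position is below \<open>n * n\<close>, hence below the input
  length, so clipping the loops changes nothing.\<close>

lemma eval_guessE [simp]:
  assumes "core u" "core v"
  shows "0 < eval xs (g # u # v # \<rho>) guessE \<longleftrightarrow> guess g u v"
proof -
  let ?c = "card {v. core v}"
  have "rank u * ?c + rank v < ?c * ?c" using assms rank_less mat_index_bound by blast
  also have "\<dots> \<le> n * n" using card_core_le_n by (intro mult_le_mono) auto
  finally have "rank u * ?c + rank v \<le> length xs" by (simp add: len)
  moreover have "rank u \<le> n" using rank_less[OF assms(1)] card_core_le_n by linarith
  then have "min (rank u) (length xs) = rank u" unfolding len by (rule min_add_square)
  ultimately show ?thesis by (simp add: guessE_def eval_bitE guess_def)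
qed

definition guess_set :: "nat \<Rightarrow> nat set" where
  "guess_set g = {v. core v \<and> guess g v v}"

lemma eval_memE [simp]: "0 < eval xs (v # g # \<rho>) memE \<longleftrightarrow> v \<in> guess_set g"
  by (simp add: memE_def guess_set_def cong: conj_cong)

lemma eval_aboveE [simp]: "0 < eval xs (t # v # \<rho>) aboveE \<longleftrightarrow> v \<in> above t"
  by (simp add: aboveE_def above_def)

lemma eval_selE [simp]: "0 < eval xs (v # s # t # g # \<rho>) selE \<longleftrightarrow> v \<in> sel (guess_set g) t s"
proof -
  have "(\<exists>h<n. pendant v h \<and> h \<notin> guess_set g) \<longleftrightarrow> (\<exists>h. pendant v h \<and> h \<notin> guess_set g)"
    using pendant_lt by blast
  moreover have "(\<exists>u<n. iso_edge v u \<and> v < u) \<longleftrightarrow> (\<exists>u. iso_edge v u \<and> v < u)"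
    using edge_ends unfolding iso_edge_def by blast
  ultimately show ?thesis by (auto simp: selE_def sel_def outer_def iso_min_def sum_pos_iff)
qed

lemma eval_touchE [simp]:
  assumes "{u, v} \<in> E"
  shows "0 < eval xs (u # v # s # t # g # \<rho>) touchE \<longleftrightarrow> {u, v} \<in> edges_at E (sel (guess_set g) t s)"
  using assms by (auto simp: touchE_def edges_at_def)

lemma eval_matE [simp]:
  assumes "u < v"
  shows "0 < eval xs (u # v # s # t # g # \<rho>) matE \<longleftrightarrow> {u, v} \<in> mat (guess_set g) (guess g) t s"
proof -
  have "0 < eval xs (u # v # s # t # g # \<rho>) matE \<longleftrightarrow> {u, v} \<in> E \<and> {u, v} \<in> edges_at E (sel (guess_set g) t s) \<and>
     ((core u \<and> core v \<and> guess g u v) \<or> iso_edge u v)"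
    by (simp add: matE_def wt_pos_iff cong: conj_cong)
  moreover have "(\<exists>u' v'. {u, v} = {u', v'} \<and> u' < v' \<and> core u' \<and> core v' \<and> guess g u' v') \<longleftrightarrow>
     core u \<and> core v \<and> guess g u v"
    using assms by (auto simp: doubleton_eq_iff)
  moreover have "(\<exists>u' v'. {u, v} = {u', v'} \<and> iso_edge u' v') \<longleftrightarrow> iso_edge u v"
    using iso_edge_sym by (auto simp: doubleton_eq_iff)
  ultimately show ?thesis unfolding mat_def by (auto simp: edges_at_def)
qed

lemma sel_lt: "v \<in> sel (guess_set g) t s \<Longrightarrow> v < n"
  using outer_D iso_min_D core_lt by (auto simp: sel_def guess_set_def)

lemma mat_subset: "mat S Q t s \<subseteq> E" by (auto simp: mat_def edges_at_def)

lemma eval_cardE [simp]: "eval xs (s # t # g # \<rho>) cardE = card (sel (guess_set g) t s)"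
proof -
  have "{v. v < n \<and> v \<in> sel (guess_set g) t s} = sel (guess_set g) t s" using sel_lt by blast
  then show ?thesis by (simp add: cardE_def)
qed

lemma eval_coverE [simp]:
  "eval xs (s # t # g # \<rho>) coverE = sum w (edges_at E (sel (guess_set g) t s))"
proof -
  let ?X = "edges_at E (sel (guess_set g) t s)"
  \<comment> \<open>\<open>eval_touchE\<close> speaks about edges only; on other pairs both sides
    are 0 because \<open>wt\<close> vanishes.\<close>
  have "(if u < v \<and> 0 < eval xs (u # v # s # t # g # \<rho>') touchE then wt u v else 0) =
    (if u < v \<and> {u, v} \<in> ?X then wt u v else 0)" for u v \<rho>'
    by (cases "{u, v} \<in> E") (auto simp: wt_def edges_at_def)
  moreover have "?X \<subseteq> E" by (auto simp: edges_at_def)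
  ultimately show ?thesis by (simp add: coverE_def sum_edges cong: if_cong)
qed

lemma eval_matchE [simp]:
  "eval xs (s # t # g # \<rho>) matchE = sum w (mat (guess_set g) (guess g) t s)"
  by (simp add: matchE_def sum_edges[OF mat_subset] cong: conj_cong if_cong)

lemma eval_disjE [simp]:
  "0 < eval xs (s # t # g # \<rho>) disjE \<longleftrightarrow> disjoint (mat (guess_set g) (guess g) t s)"
proof -
  let ?M = "mat (guess_set g) (guess g) t s"
  have "(u < v \<and> {u, v} \<in> ?M \<or> v < u \<and> {v, u} \<in> ?M) \<longleftrightarrow> {u, v} \<in> ?M" for u v
    using edge_ends[of u v] subsetD[OF mat_subset, of "{u, v}"]
    by (cases u v rule: linorder_cases) (auto simp: insert_commute)
  then show ?thesis
    unfolding disjoint_edges_iff[OF mat_subset] by (simp add: disjE_def cong: conj_cong)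
qed

lemma eval_checkE [simp]:
  "0 < eval xs (s # t # g # \<rho>) checkE \<longleftrightarrow> card (sel (guess_set g) t s) \<le> k1 \<and>
     k2 \<le> sum w (edges_at E (sel (guess_set g) t s)) \<and>
     k3 \<le> sum w (mat (guess_set g) (guess g) t s) \<and> disjoint (mat (guess_set g) (guess g) t s)"
  by (simp add: checkE_def del: eval.simps)

lemma eval_searchE [simp]:
  "0 < eval xs (g # \<rho>) searchE \<longleftrightarrow> (\<exists>t\<le>n. \<exists>s\<le>n. 0 < eval xs (s # t # g # \<rho>) checkE)"
proof -
  have "min (n + 1) (length xs) = n + 1"
    unfolding len using le_square[of n] by (intro min_absorb1) linarith
  then show ?thesis by (simp add: searchE_def sum_pos_iff less_Suc_eq_le del: eval_checkE sum.lessThan_Suc)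
qed

lemma deg_2_core: "{u, v} \<in> E \<Longrightarrow> 2 \<le> deg u \<Longrightarrow> core u"
  using edge_ends by (auto simp: core_def)

lemma eval_bipE [simp]:
  "0 < eval xs (g # \<rho>) bipE \<longleftrightarrow>
     (\<forall>u v. {u, v} \<in> E \<and> 2 \<le> deg u \<and> 2 \<le> deg v \<longrightarrow> guess g u u \<noteq> guess g v v)"
proof -
  have *: "{u, v} \<in> E \<and> 2 \<le> deg u \<and> 2 \<le> deg v \<Longrightarrow> core u \<and> core v" for u v
    using deg_2_core[of u v] deg_2_core[of v u] by (simp add: insert_commute)
  \<comment> \<open>\<open>eval_guessE\<close> needs core vertices; the guard provides them, as both
    ends have degree at least 2.\<close>
  have eq: "\<not> ({u, v} \<in> E \<and> 2 \<le> deg u \<and> 2 \<le> deg v) \<or>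
       0 < eval xs (g # u # u # \<sigma>) guessE \<and> \<not> 0 < eval xs (g # v # v # \<sigma>) guessE \<or>
       0 < eval xs (g # v # v # \<sigma>) guessE \<and> \<not> 0 < eval xs (g # u # u # \<sigma>) guessE \<longleftrightarrow>
     ({u, v} \<in> E \<and> 2 \<le> deg u \<and> 2 \<le> deg v \<longrightarrow> guess g u u \<noteq> guess g v v)" for u v \<sigma>
  proof (cases "{u, v} \<in> E \<and> 2 \<le> deg u \<and> 2 \<le> deg v")
    case True
    then have "core u" "core v" using * by blast+
    then show ?thesis using True by auto
  qed auto
  have "0 < eval xs (g # \<rho>) bipE \<longleftrightarrow>
     (\<forall>u<n. \<forall>v<n. \<not> ({u, v} \<in> E \<and> 2 \<le> deg u \<and> 2 \<le> deg v) \<or>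
       0 < eval xs (g # u # u # v # u # g # \<rho>) guessE \<and> \<not> 0 < eval xs (g # v # v # v # u # g # \<rho>) guessE \<or>
       0 < eval xs (g # v # v # v # u # g # \<rho>) guessE \<and> \<not> 0 < eval xs (g # u # u # v # u # g # \<rho>) guessE)"
    by (simp add: bipE_def wt_pos_iff del: eval_guessE)
  also have "\<dots> \<longleftrightarrow> (\<forall>u<n. \<forall>v<n. {u, v} \<in> E \<and> 2 \<le> deg u \<and> 2 \<le> deg v \<longrightarrow> guess g u u \<noteq> guess g v v)"
    unfolding eq ..
  also have "\<dots> \<longleftrightarrow> (\<forall>u v. {u, v} \<in> E \<and> 2 \<le> deg u \<and> 2 \<le> deg v \<longrightarrow> guess g u u \<noteq> guess g v v)"
    using edge_ends by blast
  finally show ?thesis .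
qed

lemma eval_paramE [simp]: "eval xs \<rho> paramE = card (V_ge2 {..<n} E)"
  by (simp add: paramE_def V_ge2_def)

lemma eval_posE [simp]: "0 < eval xs \<rho> posE \<longleftrightarrow> 0 < k1 \<and> 0 < k2 \<and> 0 < k3"
  by (simp add: posE_def del: eval.simps)

abbreviation "bound \<equiv> 2 ^ (4 * (card (V_ge2 {..<n} E))\<^sup>2)"

text \<open>The range of guesses made for solutions also accommodates every colouring, which is
  stored on the diagonal.\<close>

lemma bipartite_guess:
  "bipartite {..<n} E \<longleftrightarrow> (\<exists>g<bound. 0 < eval xs (g # \<rho>) bipE)" (is "?L \<longleftrightarrow> ?R")
proof
  assume ?L
  then obtain Q :: "nat \<Rightarrow> bool" where Q: "\<forall>u v. {u, v} \<in> E \<and> 2 \<le> deg u \<and> 2 \<le> deg v \<longrightarrow> Q u \<noteq> Q v"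
    unfolding bipartite_iff by blast
  obtain g where g: "g < bound" "\<forall>u v. core u \<longrightarrow> core v \<longrightarrow> guess g u v = Q u"
    using exists_guess[of "\<lambda>u v. Q u"] by blast
  have "guess g u u \<noteq> guess g v v" if "{u, v} \<in> E" "2 \<le> deg u" "2 \<le> deg v" for u v
  proof -
    have "core u" "core v"
      using that deg_2_core[of u v] deg_2_core[of v u] by (simp_all add: insert_commute)
    then show ?thesis using Q that g(2) by metis
  qed
  then show ?R using g(1) by auto
next
  assume ?R
  then obtain g where "\<forall>u v. {u, v} \<in> E \<and> 2 \<le> deg u \<and> 2 \<le> deg v \<longrightarrow> guess g u u \<noteq> guess g v v" by auto
  then show ?L unfolding bipartite_iff by (intro exI[of _ "\<lambda>u. guess g u u"])
qed

lemma mepvcb_yes_guess: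
  "mepvcb_yes {..<n} E w k1 k2 k3 \<longleftrightarrow> (\<exists>g<bound. 0 < eval xs (g # \<rho>) searchE)" (is "?L \<longleftrightarrow> ?R")
proof
  assume ?L
  then obtain S Q t s where *: "S \<subseteq> {v. core v}" "t \<le> n" "s \<le> n" "card (sel S t s) \<le> k1"
      "k2 \<le> sum w (edges_at E (sel S t s))" "disjoint (mat S Q t s)" "k3 \<le> sum w (mat S Q t s)"
    unfolding normal_form by blast
  obtain g where g: "g < bound"
      \<comment> \<open>The two uses of the bits do not clash: \<open>guess_set\<close> reads the
        diagonal, \<open>mat\<close> only pairs with \<open>u < v\<close>.\<close>
      "\<forall>u v. core u \<longrightarrow> core v \<longrightarrow> guess g u v = (if u = v then u \<in> S else Q u v)"
    using exists_guess[of "\<lambda>u v. if u = v then u \<in> S else Q u v"] by blast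
  have S: "guess_set g = S" using *(1) g(2) by (auto simp: guess_set_def)
  have "(u < v \<and> core u \<and> core v \<and> guess g u v) \<longleftrightarrow> (u < v \<and> core u \<and> core v \<and> Q u v)" for u v
    using g(2) by auto
  then have "mat S (guess g) t s = mat S Q t s" unfolding mat_def by simp
  then have "0 < eval xs (s # t # g # \<rho>) checkE" using * S by simp
  then show ?R using g(1) *(2,3) by auto
next
  assume ?R
  then obtain g t s where "t \<le> n" "s \<le> n" "0 < eval xs (s # t # g # \<rho>) checkE" by auto
  moreover have "guess_set g \<subseteq> {v. core v}" by (auto simp: guess_set_def)
  ultimately show ?L unfolding normal_form by auto
qed

lemma valid: "0 < eval xs \<rho> validE"
  unfolding eval_validE using wgraph xs by blast

lemma eval_mainE: "eval xs [] mainE = (if xs \<in> M_EPVCB then 1 else 0)"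
proof -
  have "eval xs [] mainE = (if 0 < k1 \<and> 0 < k2 \<and> 0 < k3 \<and>
      (\<exists>g<bound. 0 < eval xs [g, bound, card (V_ge2 {..<n} E)] bipE) \<and>
      (\<exists>g<bound. 0 < eval xs [g, bound, card (V_ge2 {..<n} E)] searchE) then 1 else 0)"
    using valid[of "[]"] by (simp add: mainE_def eval_powE sum_pos_iff del: eval_bipE eval_searchE)
  also have "\<dots> = (if xs \<in> M_EPVCB then 1 else 0)"
    unfolding bipartite_guess[symmetric] mepvcb_yes_guess[symmetric]
    using encode_in_M_EPVCB_iff[OF wgraph, of k1 k2 k3] by (auto simp: xs)
  finally show ?thesis .
qed

end

lemma eval_mainE_invalid:
  assumes "\<not> 0 < eval xs [] validE"
  shows "eval xs [] mainE = (if xs \<in> M_EPVCB then 1 else 0)"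
proof -
  have "xs \<notin> M_EPVCB" using assms unfolding eval_validE M_EPVCB_def by blast
  then show ?thesis using assms by (simp add: mainE_def)
qed

section \<open>Running time\<close>

definition fpt_bound :: "nat \<Rightarrow> nat" where
  "fpt_bound k = 2 ^ (4 * k\<^sup>2)"

lemma computable_fpt_bound: "computable fpt_bound"
proof -
  have "eval [k] [] (Bind (Inp (Num 0)) powE) = fpt_bound k" for k
    by (simp add: eval_powE fpt_bound_def)
  then show ?thesis unfolding computable_def using program_outputs by metis
qed

lemma cost_mainE:
  "\<exists>p :: nat poly. \<forall>xs. cost xs [] mainE + 2 \<le> fpt_bound (num_V_ge2 xs) * poly p (length xs)"
proof -
  obtain pv pb ps pk pp :: "nat poly" where p:
    "\<And>xs \<rho>. cost xs \<rho> validE \<le> poly pv (length xs)" "\<And>xs \<rho>. cost xs \<rho> bipE \<le> poly pb (length xs)"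
    "\<And>xs \<rho>. cost xs \<rho> searchE \<le> poly ps (length xs)" "\<And>xs \<rho>. cost xs \<rho> paramE \<le> poly pk (length xs)"
    "\<And>xs \<rho>. cost xs \<rho> posE \<le> poly pp (length xs)"
    using clipped_exps[THEN clipped_cost_poly] by metis
  have "cost xs [] mainE + 2 \<le>
      fpt_bound (num_V_ge2 xs) * poly (pv + pk + pp + pb + ps + [:100:]) (length xs)" for xs
  proof (cases "0 < eval xs [] validE")
    \<comment> \<open>Only \<open>validE\<close> is paid for here, and the parameter factor is at
      least 1 whatever \<open>num_V_ge2\<close> yields.\<close>
    case False
    have "1 \<le> fpt_bound (num_V_ge2 xs)" by (simp add: fpt_bound_def)
    have "cost xs [] mainE + 2 \<le> 1 * poly (pv + pk + pp + pb + ps + [:100:]) (length xs)"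
      using False p(1)[of xs "[]"] by (simp add: mainE_def)
    also have "\<dots> \<le> fpt_bound (num_V_ge2 xs) * poly (pv + pk + pp + pb + ps + [:100:]) (length xs)"
      by (intro mult_le_mono1) fact
    finally show ?thesis .
  next
    case True
    then obtain n E w k1 k2 k3 where g: "weighted_graph {..<n} E w" "xs = encode n E w k1 k2 k3"
      unfolding eval_validE by blast
    interpret mepvcb_instance n E w k1 k2 k3 xs by unfold_locales (use g in auto)
    define k where "k = card (V_ge2 {..<n} E)"
    define G where "G = fpt_bound k"
    have num: "num_V_ge2 xs = k" using num_V_ge2_encode[OF g(1)] by (simp add: g(2) k_def)
    have G1: "1 \<le> G" by (simp add: G_def fpt_bound_def)
    let ?B = "Sum (Var 0) bipE" and ?S = "Sum (Var 0) searchE"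
    let ?\<rho> = "[G, k]"
    let ?L = "length xs"
    have cB: "cost xs ?\<rho> ?B \<le> 4 + G * (poly pb ?L + 5)"
    proof -
      have "(\<Sum>i<G. cost xs (i # ?\<rho>) bipE + 1 + 4) \<le> (\<Sum>i<G. poly pb ?L + 5)"
        using p(2) by (intro sum_mono) simp
      then show ?thesis by simp
    qed
    have cS: "cost xs ?\<rho> ?S \<le> 4 + G * (poly ps ?L + 5)"
    proof -
      have "(\<Sum>i<G. cost xs (i # ?\<rho>) searchE + 1 + 4) \<le> (\<Sum>i<G. poly ps ?L + 5)"
        using p(3) by (intro sum_mono) simp
      then show ?thesis by simp
    qed
    have "cost xs [] mainE \<le> cost xs [] validE + cost xs [] paramE + cost xs [k] powE +
        cost xs ?\<rho> posE + cost xs ?\<rho> ?B + cost xs ?\<rho> ?S + 20"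
      using True unfolding mainE_def Bool_def And_def
      by (simp add: eval_powE k_def[symmetric] G_def fpt_bound_def del: cost.simps(10) eval.simps(10))
    also have "\<dots> \<le> poly pv ?L + poly pk ?L + 60 * G + poly pp ?L +
        (4 + G * (poly pb ?L + 5)) + (4 + G * (poly ps ?L + 5)) + 20"
      using p(1)[of xs "[]"] p(4)[of xs "[]"] p(5)[of xs ?\<rho>] cost_powE[of xs k "[]"] cB cS
      by (simp add: G_def fpt_bound_def del: cost.simps)
    \<comment> \<open>The 30 collects 20, twice 4 and the 2 steps of the final \<open>move\<close>;
      the 70 collects 60 from \<open>powE\<close> and 5 per round of each of the two
      searches.\<close>
    finally have "cost xs [] mainE + 2 \<le>
        (poly pv ?L + poly pk ?L + poly pp ?L + 30) * 1 + G * (poly pb ?L + poly ps ?L + 70)"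
      by (simp add: algebra_simps)
    also have "\<dots> \<le> (poly pv ?L + poly pk ?L + poly pp ?L + 30) * G + G * (poly pb ?L + poly ps ?L + 70)"
      using G1 by (intro add_mono mult_le_mono2) auto
    also have "\<dots> = G * poly (pv + pk + pp + pb + ps + [:100:]) ?L"
      by (simp add: algebra_simps)
    finally show ?thesis by (simp add: num G_def)
  qed
  then show ?thesis by blast
qed

theorem theorem9:
  shows "fpt M_EPVCB num_V_ge2"
proof -
  obtain p :: "nat poly" where p:
    "\<And>xs. cost xs [] mainE + 2 \<le> fpt_bound (num_V_ge2 xs) * poly p (length xs)"
    using cost_mainE by blast
  have "outputs_within (program mainE) xs (fpt_bound (num_V_ge2 xs) * poly p (input_size xs))
      (if xs \<in> M_EPVCB then 1 else 0)" for xs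
  proof -
    have "eval xs [] mainE = (if xs \<in> M_EPVCB then 1 else 0)"
    proof (cases "0 < eval xs [] validE")
      case True
      then obtain n E w k1 k2 k3 where "weighted_graph {..<n} E w" "xs = encode n E w k1 k2 k3"
        unfolding eval_validE by blast
      then interpret mepvcb_instance n E w k1 k2 k3 xs by unfold_locales auto
      show ?thesis by (rule eval_mainE)
    qed (rule eval_mainE_invalid)
    \<comment> \<open>The cost depends on the weights only through the number of entries, because
      arithmetic takes unit time; the bit length is at least that number.\<close>
    moreover have "cost xs [] mainE + 2 \<le> fpt_bound (num_V_ge2 xs) * poly p (input_size xs)"
      using p[of xs] mult_le_mono2[OF poly_nat_mono[OF length_le_input_size]] order_trans by blast
    ultimately show ?thesis using outputs_within_mono[OF program_outputs[of mainE xs]] by simp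
  qed
  then show ?thesis unfolding fpt_def using computable_fpt_bound by blast
qed

end
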